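(* Suppose the standing assumptions (A1)–(A3) of the context hold, $\{x_k\}$ is an infinite sequence generated by the SQP algorithm of the context, MFCQ is satisfied at all accumulation points of $\{x_k\}$, the constraint functions $c_i$, $i\in\mathcal E\cup\mathcal I$, are affine, and the potential function $L$ is a KL function. Let $b\ge\sigma\ge\rho$ and $2b\ge\sigma+l$. Then the sequence $\{x_k\}$ converges to a KKT point of the problem.
   Context: Problem: $\mathcal E,\mathcal I$ are finite disjoint index sets, $m=|\mathcal E|+|\mathcal I|$, $c_i:\mathbb{R}^n\to\mathbb{R}$ for $i\in\mathcal E\cup\mathcal I$, $f:\mathbb{R}^n\to\mathbb{R}\cup\{+\infty\}$. Minimize $f(x)$ subject to $c_i(x)=0$ ($i\in\mathcal E$), $c_i(x)\ge0$ ($i\in\mathcal I$); the feasible set is $\Omega$. A KKT point is a feasible $\bar x$ for which there is $\bar\lambda\in\mathbb{R}^m$ with $0\in\bar\partial f(\bar x)-\sum_i\bar\lambda_i\nabla c_i(\bar x)$, and $\bar\lambda_i\ge0$, $\bar\lambda_ic_i(\bar x)=0$ for $i\in\mathcal I$. Notation: $[y]^-=\max\{0,-y\}$, $v(x)=\sum_{i\in\mathcal E}|c_i(x)|+\sum_{i\in\mathcal I}[c_i(x)]^-$, merit function $\phi(x,\theta)=f(x)+\theta v(x)$; $\bar\partial f$ is the Clarke subdifferential; $\|\cdot\|$ is the Euclidean norm. $f$ is upper-$C^2$ on an open set $O$ if near each point of $O$ it can be written $f(x)=\min_{t\in T}f_t(x)$ with $T$ a compact space, each $f_t$ of class $C^2$,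 and $f_t$ and its partial derivatives in $x$ up to order 2 jointly continuous in $(t,x)$. SQP algorithm: given $x_0$, $\theta_0>0$, $\eta\in(0,1)$, $\tau_\alpha\in(0,1)$, $\gamma>0$ (stopping tolerances zero: it stops only if $d_k=0$ and $v(x_k)=0$). At iteration $k$: take any $g_k\in\bar\partial f(x_k)$ and a symmetric matrix $B_k$; let $(d_k,v^k,w^k,t^k)$ solve $$\min_{d,v,w,t} f(x_k)+g_k^Td+\tfrac12 d^TB_kd+\theta_k\sum_{i\in\mathcal E}(v_i+w_i)+\theta_k\sum_{i\in\mathcal I}t_i$$ s.t. $c_i(x_k)+\nabla c_i(x_k)^Td=v_i-w_i$ ($i\in\mathcal E$), $c_i(x_k)+\nabla c_i(x_k)^Td\ge -t_i$ ($i\in\mathcal I$), $v,w,t\ge0$. Let $\lambda^{k+1}\in\mathbb{R}^m$ be the Lagrange multiplier of the linearized constraints, i.e. with some $p^{k+1},q^{k+1},r^{k+1}\ge0$: $g_k+B_kd_k-\sum_{i}\lambda_i^{k+1}\nabla c_i(x_k)=0$; $\lambda_i^{k+1}\ge0$ and $\lambda_i^{k+1}[c_i(x_k)+\nabla c_i(x_k)^Td_k+t_i^k]=0$ for $i\in\mathcal I$; $\theta_k+\lambda_i^{k+1}=p_i^{k+1}$, $\theta_k-\lambda_i^{k+1}=q_i^{k+1}$, $p_i^{k+1}v_i^k=q_i^{k+1}w_i^k=0$ for $i\in\mathcal E$; $\theta_k-\lambda_i^{k+1}=r_i^{k+1}$, $r_i^{k+1}t_i^k=0$ for $i\in\mathcal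 I$. Set $\theta_{k+1}=\max\{\theta_k,\|\lambda^{k+1}\|_\infty+\gamma\}$. Let $\alpha_k$ be the first of $1,\tau_\alpha,\tau_\alpha^2,\dots$ such that $\phi(x_k,\theta_k)-\phi(x_k+\alpha_kd_k,\theta_k)\ge\eta\alpha_k\tfrac12d_k^TB_kd_k$; set $x_{k+1}=x_k+\alpha_kd_k$. Standing assumptions. (A1) $f$ is (finite,) Lipschitz continuous and upper-$C^2$ on an open set containing the compact convex set $D$ of (A3); $\rho>0$ is a constant such that $-f+\frac\rho2\|\cdot\|^2$ is convex on $D$ and $f(x)-f(\bar x)-\langle g,x-\bar x\rangle\le\frac\rho2\|x-\bar x\|^2$ for all $x,\bar x\in D$, $g\in\bar\partial f(\bar x)$. (A2) Each $c_i$ is continuously differentiable with Lipschitz gradient, and $H\ge0$ satisfies $|c_i(x')-c_i(x)-\nabla c_i(x)^T(x'-x)|\le\frac H2\|x-x'\|^2$ for all $x,x'$ and all $i$. (A3) There is a compact convex set $D\subset\mathbb{R}^n$ with $\Omega\subseteq D$ and $x_k,\,x_k+d_k\in D$ for all $k$; the $B_k$ are symmetric, uniformly bounded, and for some $b>0$, $d^TB_kd\ge b\|d\|^2$ for all $k$ and $d\in\mathbb{R}^n$. MFCQ: for a feasible point $x$ let $\mathcal A(x)=\mathcal E\cup\{i\in\mathcal I: c_i(x)=0\}$. MFCQ holds at $x$ if $\nabla c_i(x)$, $i\in\mathcal E$, are linearly independent and there is $w\in\mathbb{R}^n$ with $\nabla c_i(x)^Tw>0$ for all $i\in\mathcal A(x)\cap\mathcal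 I$ and $\nabla c_i(x)^Tw=0$ for all $i\in\mathcal E$ (so MFCQ is a condition on feasible points). Potential function: $\sigma>0$, $l>0$ are constants; $F(x)=-f(x)+\frac12\sigma\|x\|^2$ for $x\in D$ and $F(x)=+\infty$ otherwise, with $\sigma$ such that $F$ is convex; $F^*(u)=\sup_x\{\langle u,x\rangle-F(x)\}$. Let $\bar c_i(x,w)=c_i(w)+\nabla c_i(w)^T(x-w)$, $\bar C=\{(x,w):\bar c_i(x,w)=0\ (i\in\mathcal E),\ \bar c_i(x,w)\ge0\ (i\in\mathcal I)\}$, and $i_{\bar C}$ its indicator function ($0$ on $\bar C$, $+\infty$ elsewhere). For $(x,y,w)\in(\mathbb{R}^n)^3$, $L(x,y,w)=-y^Tx+F^*(y)+\tfrac12\sigma\|x\|^2+\tfrac12 l\|x-w\|^2+i_{\bar C}(x,w)$. KL: $\partial$ denotes the limiting (general) subdifferential, $\mathrm{dom}\,\partial h=\{x:\partial h(x)\ne\emptyset\}$. A function $h$ has the KL property at $\hat x\in\mathrm{dom}\,\partial h$ if there are $a\in(0,\infty]$, a neighborhood $U$ of $\hat x$ and a continuous concave $\varphi:[0,a)\to[0,\infty)$ with $\varphi(0)=0$, $\varphi\in C^1(0,a)$, $\varphi'>0$ on $(0,a)$, such that $\varphi'(h(x)-h(\hat x))\,\mathrm{dist}(0,\partial h(x))\ge1$ for all $x\in U$ with $h(\hat x)<h(x)<h(\hat x)+a$ (with $\mathrm{dist}(0,\emptyset)=+\infty$). $h$ is a KL function if this holds at each point of $\mathrm{dom}\,\partial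 h$. *)

theory Defs
  imports "HOL-Analysis.Analysis"
begin

section \<open>Nonsmooth and variational analysis\<close>

text \<open>Clarke's generalized directional derivative and subdifferential. They are only used at points
  in a neighbourhood of which \<open>f\<close> is finite and Lipschitz continuous. The base point \<open>y\<close> may equal
  \<open>x\<close>, hence \<open>nhds\<close> and not \<open>at\<close>.\<close>

definition clarke_dir_deriv :: "('a::euclidean_space \<Rightarrow> ereal) \<Rightarrow> 'a \<Rightarrow> 'a \<Rightarrow> ereal" where
  "clarke_dir_deriv f x d =
     Limsup (nhds x \<times>\<^sub>F at_right 0) (\<lambda>(y, s). (f (y + s *\<^sub>R d) - f y) / ereal s)"

definition clarke_subdiff :: "('a::euclidean_space \<Rightarrow> ereal) \<Rightarrow> 'a \<Rightarrow> 'a set" where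
  "clarke_subdiff f x = {g. \<forall>d. ereal (g \<bullet> d) \<le> clarke_dir_deriv f x d}"

text \<open>The regular (Frechet) subdifferential, i.e.
  \<open>h y \<ge> h x + v \<bullet> (y - x) + o(norm (y - x))\<close>, and the limiting subdifferential; both are empty
  where \<open>h\<close> is not finite.\<close>

definition regular_subdiff :: "('a::euclidean_space \<Rightarrow> ereal) \<Rightarrow> 'a \<Rightarrow> 'a set" where
  "regular_subdiff h x = {v. \<bar>h x\<bar> \<noteq> \<infinity> \<and>
     (\<forall>e>0. \<forall>\<^sub>F y in nhds x. h x + ereal (v \<bullet> (y - x) - e * norm (y - x)) \<le> h y)}"

definition limiting_subdiff :: "('a::euclidean_space \<Rightarrow> ereal) \<Rightarrow> 'a \<Rightarrow> 'a set" where
  "limiting_subdiff h x = {v. \<bar>h x\<bar> \<noteq> \<infinity> \<and>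
     (\<exists>y u. y \<longlonglongrightarrow> x \<and> (\<lambda>k. h (y k)) \<longlonglongrightarrow> h x \<and>
        (\<forall>k. u k \<in> regular_subdiff h (y k)) \<and> u \<longlonglongrightarrow> v)}"

text \<open>Distance of the origin to a set; the infimum over the empty set is \<open>\<infinity>\<close> in
  \<^typ>\<open>ereal\<close> (whereas \<^const>\<open>infdist\<close> would give \<open>0\<close>).\<close>

definition dist0 :: "'a::real_normed_vector set \<Rightarrow> ereal" where
  "dist0 S = (INF v\<in>S. ereal (norm v))"

definition KL_property_at :: "('a::euclidean_space \<Rightarrow> ereal) \<Rightarrow> 'a \<Rightarrow> bool" where
  "KL_property_at h xh \<longleftrightarrow>
     (\<exists>(a::ereal) U (\<phi>::real \<Rightarrow> real) \<phi>'.
        0 < a \<and> open U \<and> xh \<in> U \<and>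
        continuous_on {s. 0 \<le> s \<and> ereal s < a} \<phi> \<and>
        concave_on {s. 0 \<le> s \<and> ereal s < a} \<phi> \<and>
        (\<forall>s. 0 \<le> s \<and> ereal s < a \<longrightarrow> 0 \<le> \<phi> s) \<and> \<phi> 0 = 0 \<and>
        (\<forall>s. 0 < s \<and> ereal s < a \<longrightarrow> (\<phi> has_real_derivative \<phi>' s) (at s) \<and> 0 < \<phi>' s) \<and>
        continuous_on {s. 0 < s \<and> ereal s < a} \<phi>' \<and>
        (\<forall>x\<in>U. h xh < h x \<and> h x < h xh + a \<longrightarrow>
           1 \<le> ereal (\<phi>' (real_of_ereal (h x - h xh))) * dist0 (limiting_subdiff h x)))"

definition KL_function :: "('a::euclidean_space \<Rightarrow> ereal) \<Rightarrow> bool" where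
  "KL_function h \<longleftrightarrow> (\<forall>x. limiting_subdiff h x \<noteq> {} \<longrightarrow> KL_property_at h x)"

definition convex_ereal_fun :: "('a::real_vector \<Rightarrow> ereal) \<Rightarrow> bool" where
  "convex_ereal_fun h \<longleftrightarrow> convex {(x, r::real). h x \<le> ereal r}"

definition conjugate :: "('a::real_inner \<Rightarrow> ereal) \<Rightarrow> 'a \<Rightarrow> ereal" where
  "conjugate h u = (SUP x. ereal (u \<bullet> x) - h x)"

text \<open>Upper-\<open>C\<^sup>2\<close> functions. The compact parameter spaces are abstract topologies on subsets of the
  type \<open>'t\<close>, so every family of compact spaces is covered by a suitable choice of \<open>'t\<close>; in an
  assumption with \<open>'t\<close> free, \<open>'t\<close> is in effect existentially quantified. \<open>G t\<close> and \<open>Q t\<close> are the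
  gradient and the Hessian of \<open>\<psi> t\<close>.\<close>

definition upper_C2_on :: "'t itself \<Rightarrow> (real^'n) set \<Rightarrow> (real^'n \<Rightarrow> ereal) \<Rightarrow> bool" where
  "upper_C2_on _ U f \<longleftrightarrow>
     (\<forall>xb\<in>U. \<exists>V (T :: 't topology) (\<psi> :: 't \<Rightarrow> real^'n \<Rightarrow> real)
          (G :: 't \<Rightarrow> real^'n \<Rightarrow> real^'n) (Q :: 't \<Rightarrow> real^'n \<Rightarrow> real^'n^'n).
        open V \<and> xb \<in> V \<and> compact_space T \<and>
        (\<forall>x\<in>V. (\<forall>t\<in>topspace T. f x \<le> ereal (\<psi> t x)) \<and> (\<exists>t\<in>topspace T. f x = ereal (\<psi> t x))) \<and>
        (\<forall>t\<in>topspace T. \<forall>x\<in>V. (GDERIV (\<psi> t) x :> G t x) \<and>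
           (G t has_derivative (\<lambda>h. Q t x *v h)) (at x)) \<and>
        continuous_map (prod_topology T (top_of_set V)) euclidean (\<lambda>(t, x). \<psi> t x) \<and>
        continuous_map (prod_topology T (top_of_set V)) euclidean (\<lambda>(t, x). G t x) \<and>
        continuous_map (prod_topology T (top_of_set V)) euclidean (\<lambda>(t, x). Q t x))"

section \<open>The constrained problem\<close>

definition grad :: "('a::euclidean_space \<Rightarrow> real) \<Rightarrow> 'a \<Rightarrow> 'a" where
  "grad h x = (THE D. GDERIV h x :> D)"

definition feasible_set :: "'i set \<Rightarrow> 'i set \<Rightarrow> ('i \<Rightarrow> 'a \<Rightarrow> real) \<Rightarrow> 'a set" where
  "feasible_set E I c = {x. (\<forall>i\<in>E. c i x = 0) \<and> (\<forall>i\<in>I. 0 \<le> c i x)}"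

definition KKT_point ::
  "'i set \<Rightarrow> 'i set \<Rightarrow> ('i \<Rightarrow> 'a::euclidean_space \<Rightarrow> real) \<Rightarrow> ('a \<Rightarrow> ereal) \<Rightarrow> 'a \<Rightarrow> bool" where
  "KKT_point E I c f x \<longleftrightarrow> x \<in> feasible_set E I c \<and>
     (\<exists>lam :: 'i \<Rightarrow> real.
        0 \<in> (\<lambda>g. g - (\<Sum>i\<in>E \<union> I. lam i *\<^sub>R grad (c i) x)) ` clarke_subdiff f x \<and>
        (\<forall>i\<in>I. 0 \<le> lam i \<and> lam i * c i x = 0))"

text \<open>Feasibility is part of MFCQ. Linear independence is that of the family of gradients, so
  equal gradients with different indices are dependent.\<close>

definition MFCQ :: "'i set \<Rightarrow> 'i set \<Rightarrow> ('i \<Rightarrow> 'a::euclidean_space \<Rightarrow> real) \<Rightarrow> 'a \<Rightarrow> bool" where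
  "MFCQ E I c x \<longleftrightarrow> x \<in> feasible_set E I c \<and>
     inj_on (\<lambda>i. grad (c i) x) E \<and> independent ((\<lambda>i. grad (c i) x) ` E) \<and>
     (\<exists>w. (\<forall>i\<in>I. c i x = 0 \<longrightarrow> 0 < grad (c i) x \<bullet> w) \<and> (\<forall>i\<in>E. grad (c i) x \<bullet> w = 0))"

definition violation :: "'i set \<Rightarrow> 'i set \<Rightarrow> ('i \<Rightarrow> 'a \<Rightarrow> real) \<Rightarrow> 'a \<Rightarrow> real" where
  "violation E I c x = (\<Sum>i\<in>E. \<bar>c i x\<bar>) + (\<Sum>i\<in>I. max 0 (- c i x))"

definition merit ::
  "'i set \<Rightarrow> 'i set \<Rightarrow> ('i \<Rightarrow> 'a \<Rightarrow> real) \<Rightarrow> ('a \<Rightarrow> ereal) \<Rightarrow> 'a \<Rightarrow> real \<Rightarrow> ereal" where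
  "merit E I c f x \<theta> = f x + ereal (\<theta> * violation E I c x)"

section \<open>The SQP algorithm\<close>

definition qp_objective ::
  "'i set \<Rightarrow> 'i set \<Rightarrow> (real^'n \<Rightarrow> ereal) \<Rightarrow> real^'n \<Rightarrow> real \<Rightarrow> real^'n \<Rightarrow> real^'n^'n
     \<Rightarrow> real^'n \<Rightarrow> ('i \<Rightarrow> real) \<Rightarrow> ('i \<Rightarrow> real) \<Rightarrow> ('i \<Rightarrow> real) \<Rightarrow> ereal" where
  "qp_objective E I f x \<theta> g B d v w t =
     f x + ereal (g \<bullet> d + 1/2 * (d \<bullet> (B *v d)) + \<theta> * (\<Sum>i\<in>E. v i + w i) + \<theta> * (\<Sum>i\<in>I. t i))"

definition qp_feasible ::
  "'i set \<Rightarrow> 'i set \<Rightarrow> ('i \<Rightarrow> real^'n \<Rightarrow> real) \<Rightarrow> real^'n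
     \<Rightarrow> real^'n \<Rightarrow> ('i \<Rightarrow> real) \<Rightarrow> ('i \<Rightarrow> real) \<Rightarrow> ('i \<Rightarrow> real) \<Rightarrow> bool" where
  "qp_feasible E I c x d v w t \<longleftrightarrow>
     (\<forall>i\<in>E. c i x + grad (c i) x \<bullet> d = v i - w i \<and> 0 \<le> v i \<and> 0 \<le> w i) \<and>
     (\<forall>i\<in>I. c i x + grad (c i) x \<bullet> d \<ge> - t i \<and> 0 \<le> t i)"

definition qp_solution ::
  "'i set \<Rightarrow> 'i set \<Rightarrow> ('i \<Rightarrow> real^'n \<Rightarrow> real) \<Rightarrow> (real^'n \<Rightarrow> ereal) \<Rightarrow> real^'n \<Rightarrow> real
     \<Rightarrow> real^'n \<Rightarrow> real^'n^'n \<Rightarrow> real^'n \<Rightarrow> ('i \<Rightarrow> real) \<Rightarrow> ('i \<Rightarrow> real) \<Rightarrow> ('i \<Rightarrow> real) \<Rightarrow> bool" where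
  "qp_solution E I c f x \<theta> g B d v w t \<longleftrightarrow>
     qp_feasible E I c x d v w t \<and>
     (\<forall>d' v' w' t'. qp_feasible E I c x d' v' w' t' \<longrightarrow>
        qp_objective E I f x \<theta> g B d v w t \<le> qp_objective E I f x \<theta> g B d' v' w' t')"

definition qp_multiplier ::
  "'i set \<Rightarrow> 'i set \<Rightarrow> ('i \<Rightarrow> real^'n \<Rightarrow> real) \<Rightarrow> real^'n \<Rightarrow> real \<Rightarrow> real^'n \<Rightarrow> real^'n^'n
     \<Rightarrow> real^'n \<Rightarrow> ('i \<Rightarrow> real) \<Rightarrow> ('i \<Rightarrow> real) \<Rightarrow> ('i \<Rightarrow> real) \<Rightarrow> ('i \<Rightarrow> real) \<Rightarrow> bool" where
  "qp_multiplier E I c x \<theta> g B d v w t lam \<longleftrightarrow>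
     (\<exists>p q r :: 'i \<Rightarrow> real.
        g + B *v d - (\<Sum>i\<in>E \<union> I. lam i *\<^sub>R grad (c i) x) = 0 \<and>
        (\<forall>i\<in>I. 0 \<le> lam i \<and> lam i * (c i x + grad (c i) x \<bullet> d + t i) = 0) \<and>
        (\<forall>i\<in>E. 0 \<le> p i \<and> 0 \<le> q i \<and> \<theta> + lam i = p i \<and> \<theta> - lam i = q i \<and>
           p i * v i = 0 \<and> q i * w i = 0) \<and>
        (\<forall>i\<in>I. 0 \<le> r i \<and> \<theta> - lam i = r i \<and> r i * t i = 0))"

text \<open>The inserted \<open>0\<close> only matters when there are no constraints.\<close>

definition max_norm_on :: "'i set \<Rightarrow> ('i \<Rightarrow> real) \<Rightarrow> real" where
  "max_norm_on J lam = Max (insert 0 ((\<lambda>i. \<bar>lam i\<bar>) ` J))"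

definition sufficient_decrease ::
  "'i set \<Rightarrow> 'i set \<Rightarrow> ('i \<Rightarrow> real^'n \<Rightarrow> real) \<Rightarrow> (real^'n \<Rightarrow> ereal) \<Rightarrow> real
     \<Rightarrow> real^'n \<Rightarrow> real \<Rightarrow> real^'n^'n \<Rightarrow> real^'n \<Rightarrow> real \<Rightarrow> bool" where
  "sufficient_decrease E I c f \<eta> x \<theta> B d \<alpha> \<longleftrightarrow>
     merit E I c f x \<theta> - merit E I c f (x + \<alpha> *\<^sub>R d) \<theta> \<ge> ereal (\<eta> * \<alpha> * (1/2) * (d \<bullet> (B *v d)))"

text \<open>An infinite run: the stopping test \<open>d k = 0\<close>, \<open>violation (x k) = 0\<close> never succeeds. \<open>lam 0\<close>
  is irrelevant.\<close>

definition SQP_run ::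
  "'i set \<Rightarrow> 'i set \<Rightarrow> ('i \<Rightarrow> real^'n \<Rightarrow> real) \<Rightarrow> (real^'n \<Rightarrow> ereal) \<Rightarrow> real \<Rightarrow> real \<Rightarrow> real
     \<Rightarrow> (nat \<Rightarrow> real^'n) \<Rightarrow> (nat \<Rightarrow> real) \<Rightarrow> (nat \<Rightarrow> real^'n) \<Rightarrow> (nat \<Rightarrow> real^'n^'n) \<Rightarrow> (nat \<Rightarrow> real^'n)
     \<Rightarrow> (nat \<Rightarrow> 'i \<Rightarrow> real) \<Rightarrow> (nat \<Rightarrow> 'i \<Rightarrow> real) \<Rightarrow> (nat \<Rightarrow> 'i \<Rightarrow> real)
     \<Rightarrow> (nat \<Rightarrow> 'i \<Rightarrow> real) \<Rightarrow> (nat \<Rightarrow> real) \<Rightarrow> bool" where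
  "SQP_run E I c f \<eta> \<tau> \<gamma> x \<theta> g B d v w t lam \<alpha> \<longleftrightarrow>
     0 < \<theta> 0 \<and>
     (\<forall>k. g k \<in> clarke_subdiff f (x k) \<and>
        transpose (B k) = B k \<and>
        qp_solution E I c f (x k) (\<theta> k) (g k) (B k) (d k) (v k) (w k) (t k) \<and>
        \<not> (d k = 0 \<and> violation E I c (x k) = 0) \<and>
        qp_multiplier E I c (x k) (\<theta> k) (g k) (B k) (d k) (v k) (w k) (t k) (lam (Suc k)) \<and>
        \<theta> (Suc k) = max (\<theta> k) (max_norm_on (E \<union> I) (lam (Suc k)) + \<gamma>) \<and>
        (\<exists>j. \<alpha> k = \<tau> ^ j \<and> sufficient_decrease E I c f \<eta> (x k) (\<theta> k) (B k) (d k) (\<tau> ^ j) \<and>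
           (\<forall>j'<j. \<not> sufficient_decrease E I c f \<eta> (x k) (\<theta> k) (B k) (d k) (\<tau> ^ j'))) \<and>
        x (Suc k) = x k + \<alpha> k *\<^sub>R d k)"

definition accumulation_point :: "(nat \<Rightarrow> 'a::topological_space) \<Rightarrow> 'a \<Rightarrow> bool" where
  "accumulation_point x xh \<longleftrightarrow> (\<exists>r. strict_mono r \<and> (x \<circ> r) \<longlonglongrightarrow> xh)"

section \<open>The potential function\<close>

definition pot_F :: "('a::euclidean_space \<Rightarrow> ereal) \<Rightarrow> 'a set \<Rightarrow> real \<Rightarrow> 'a \<Rightarrow> ereal" where
  "pot_F f D \<sigma> x = (if x \<in> D then - f x + ereal (1/2 * \<sigma> * (norm x)\<^sup>2) else \<infinity>)"

definition linearized_set ::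
  "'i set \<Rightarrow> 'i set \<Rightarrow> ('i \<Rightarrow> 'a::euclidean_space \<Rightarrow> real) \<Rightarrow> ('a \<times> 'a) set" where
  "linearized_set E I c = {(x, w). (\<forall>i\<in>E. c i w + grad (c i) w \<bullet> (x - w) = 0) \<and>
                                   (\<forall>i\<in>I. 0 \<le> c i w + grad (c i) w \<bullet> (x - w))}"

definition indicator_inf :: "'a set \<Rightarrow> 'a \<Rightarrow> ereal" where
  "indicator_inf S z = (if z \<in> S then 0 else \<infinity>)"

definition potential ::
  "'i set \<Rightarrow> 'i set \<Rightarrow> ('i \<Rightarrow> 'a::euclidean_space \<Rightarrow> real) \<Rightarrow> ('a \<Rightarrow> ereal) \<Rightarrow> 'a set
     \<Rightarrow> real \<Rightarrow> real \<Rightarrow> 'a \<times> 'a \<times> 'a \<Rightarrow> ereal" where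
  "potential E I c f D \<sigma> l = (\<lambda>(x, y, w).
     ereal (- (y \<bullet> x)) + conjugate (pot_F f D \<sigma>) y + ereal (1/2 * \<sigma> * (norm x)\<^sup>2)
       + ereal (1/2 * l * (norm (x - w))\<^sup>2) + indicator_inf (linearized_set E I c) (x, w))"

end

theory Submission
  imports Defs
begin

text \<open>Since the constraints are affine and \<open>b \<ge> \<rho>\<close>, every unit step is accepted, so
  \<open>x (Suc k) = x k + d k\<close>. By MFCQ the multipliers are bounded, hence the penalty parameters converge,
  the slacks eventually vanish and the iterates become feasible. From then on the values \<open>L k\<close> of the
  potential at \<open>(x (Suc k), \<sigma> *\<^sub>R x k - g k, x k)\<close> satisfy
  \<open>f (x (Suc k)) + l/2 * (norm (d k))\<^sup>2 \<le> L k \<le> f (x k)\<close>, because \<open>\<sigma> *\<^sub>R x k - g k\<close> is a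
  subgradient of \<open>pot_F f D \<sigma>\<close> at \<open>x k\<close> and \<open>2 * b \<ge> \<sigma> + l\<close>, and the QP optimality conditions yield a
  subgradient of the potential of norm \<open>O(norm (d k))\<close> at that point. Hence \<open>L\<close> decreases by at least
  \<open>l/2 * (norm (d k))\<^sup>2\<close> per step, the KL inequality turns this into summability of \<open>norm (d k)\<close>, and
  the optimality conditions pass to the limit.\<close>

section \<open>Subdifferentials\<close>

lemma regular_subdiff_subset_limiting: "regular_subdiff h x \<subseteq> limiting_subdiff h x"
proof
  fix v assume v: "v \<in> regular_subdiff h x"
  then show "v \<in> limiting_subdiff h x"
    unfolding limiting_subdiff_def
    by (intro CollectI conjI exI[of _ "\<lambda>_. x"] exI[of _ "\<lambda>_. v"]) (auto simp: regular_subdiff_def)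
qed

text \<open>Testing \<open>g\<close> in its own direction bounds \<open>g \<bullet> g\<close> by a
  limit of difference quotients along \<open>g\<close>, which the Lipschitz constant keeps below
  \<open>K * norm g\<close>. It makes the chosen subgradients a bounded sequence.\<close>

lemma clarke_subdiff_norm_le:
  fixes f :: "'a::euclidean_space \<Rightarrow> ereal"
  assumes "open U" "x \<in> U" and fin: "\<And>z. z \<in> U \<Longrightarrow> f z = ereal (fr z)"
    and lip: "K-lipschitz_on U fr" and g: "g \<in> clarke_subdiff f x"
  shows "norm g \<le> K"
proof -
  have K: "0 \<le> K" using lip by (rule lipschitz_on_nonneg)
  have "clarke_dir_deriv f x g \<le> ereal (K * norm g)"
    unfolding clarke_dir_deriv_def
  proof (rule Limsup_bounded)
    have "((\<lambda>p. fst p + snd p *\<^sub>R g) \<longlongrightarrow> x + 0 *\<^sub>R g) (nhds x \<times>\<^sub>F at_right 0)"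
      by (intro tendsto_intros filterlim_fst filterlim_compose[OF _ filterlim_snd]
           tendsto_ident_at filterlim_ident)
    then have 1: "\<forall>\<^sub>F p in nhds x \<times>\<^sub>F at_right 0. fst p + snd p *\<^sub>R g \<in> U"
      using assms(1,2) by (simp add: topological_tendstoD)
    have 2: "\<forall>\<^sub>F p in nhds x \<times>\<^sub>F at_right (0::real). fst p \<in> U"
      using assms(1,2) by (intro topological_tendstoD[OF filterlim_fst])
    have 3: "\<forall>\<^sub>F p in nhds x \<times>\<^sub>F at_right (0::real). snd p > 0"
      by (rule eventually_compose_filterlim[OF _ filterlim_snd]) (simp add: eventually_at_right_less)
    show "\<forall>\<^sub>F p in nhds x \<times>\<^sub>F at_right 0.
        (case p of (y, s) \<Rightarrow> (f (y + s *\<^sub>R g) - f y) / ereal s) \<le> ereal (K * norm g)"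
      using 1 2 3
    proof eventually_elim
      case (elim p)
      obtain y s where p: "p = (y, s)" by fastforce
      have s: "s > 0" and y: "y \<in> U" "y + s *\<^sub>R g \<in> U" using elim p by auto
      have "fr (y + s *\<^sub>R g) - fr y \<le> K * (s * norm g)"
        using lipschitz_onD[OF lip y(2,1)] s by (simp add: dist_norm)
      then have "(fr (y + s *\<^sub>R g) - fr y) / s \<le> K * norm g"
        using s by (simp add: divide_simps algebra_simps)
      then show ?case using p s y fin by simp
    qed
  qed
  moreover have "ereal (g \<bullet> g) \<le> clarke_dir_deriv f x g"
    using g by (simp add: clarke_subdiff_def)
  ultimately have "ereal (g \<bullet> g) \<le> ereal (K * norm g)" by (rule order_trans[rotated])
  then have "norm g * norm g \<le> K * norm g"
    by (simp add: dot_square_norm power2_eq_square)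
  then show ?thesis using K by (cases "norm g = 0") (auto dest: mult_right_le_imp_le)
qed

text \<open>The generalized derivative is upper semicontinuous in its base point: a bound on the
  difference quotients that holds near \<open>x0\<close> holds near \<open>x k\<close> for large
  \<open>k\<close>, since an open neighbourhood of \<open>x0\<close> is one of \<open>x k\<close> as
  well. This carries stationarity to the limit.\<close>

lemma clarke_subdiff_closed_graph:
  fixes f :: "'a::euclidean_space \<Rightarrow> ereal"
  assumes x: "x \<longlonglongrightarrow> x0" and g: "g \<longlonglongrightarrow> g0"
    and sub: "\<And>k. g k \<in> clarke_subdiff f (x k)"
  shows "g0 \<in> clarke_subdiff f x0"
  unfolding clarke_subdiff_def
proof (intro CollectI allI)
  fix d
  show "ereal (g0 \<bullet> d) \<le> clarke_dir_deriv f x0 d"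
  proof (rule dense_ge)
    \<comment> \<open>Only a strict bound on a \<open>Limsup\<close> yields an eventual bound on the
      quotients, hence the detour through every larger \<open>C\<close>.\<close>
    fix C assume "clarke_dir_deriv f x0 d < C"
    then have "\<forall>\<^sub>F p in nhds x0 \<times>\<^sub>F at_right 0.
        (case p of (y, s) \<Rightarrow> (f (y + s *\<^sub>R d) - f y) / ereal s) < C"
      unfolding clarke_dir_deriv_def by (rule Limsup_lessD)
    then obtain P Q where P: "eventually P (nhds x0)" and Q: "eventually Q (at_right (0::real))"
      and PQ: "\<And>y s. P y \<Longrightarrow> Q s \<Longrightarrow> (f (y + s *\<^sub>R d) - f y) / ereal s < C"
      unfolding eventually_prod_filter by auto
    have "\<forall>\<^sub>F k in sequentially. eventually P (nhds (x k))"
      using P x by (subst (asm) eventually_eventually[symmetric]) (rule eventually_compose_filterlim)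
    then have "\<forall>\<^sub>F k in sequentially. ereal (g k \<bullet> d) \<le> C"
    proof eventually_elim
      case (elim k)
      have "clarke_dir_deriv f (x k) d \<le> C"
        unfolding clarke_dir_deriv_def
      proof (rule Limsup_bounded)
        show "\<forall>\<^sub>F p in nhds (x k) \<times>\<^sub>F at_right 0.
          (case p of (y, s) \<Rightarrow> (f (y + s *\<^sub>R d) - f y) / ereal s) \<le> C"
          unfolding eventually_prod_filter using elim Q PQ by (fastforce intro: less_imp_le)
      qed
      then show ?case using sub[of k] by (auto simp: clarke_subdiff_def intro: order_trans)
    qed
    moreover have "(\<lambda>k. ereal (g k \<bullet> d)) \<longlonglongrightarrow> ereal (g0 \<bullet> d)"
      by (intro tendsto_intros tendsto_ereal g)
    ultimately show "ereal (g0 \<bullet> d) \<le> C"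
      by (intro tendsto_upperbound[OF _ _ sequentially_bot])
  qed
qed

section \<open>Subsequences\<close>

lemma bounded_family_convergent_subseq:
  fixes m :: "nat \<Rightarrow> 'i \<Rightarrow> 'a::heine_borel"
  assumes "finite J" "\<And>i. i \<in> J \<Longrightarrow> bounded (range (\<lambda>k. m k i))"
  shows "\<exists>r l. strict_mono (r :: nat \<Rightarrow> nat) \<and> (\<forall>i\<in>J. (\<lambda>k. m (r k) i) \<longlonglongrightarrow> l i)"
  using assms
proof (induction J)
  case empty
  then show ?case using strict_mono_id by auto
next
  case (insert j J)
  then obtain r l where r: "strict_mono r" "\<forall>i\<in>J. (\<lambda>k. m (r k) i) \<longlonglongrightarrow> l i" by blast
  have "bounded (range (\<lambda>k. m (r k) j))"
    by (rule bounded_subset[OF insert.prems[of j]]) auto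
  then obtain q lj where q: "strict_mono q" "((\<lambda>k. m (r k) j) \<circ> q) \<longlonglongrightarrow> lj"
    using bounded_imp_convergent_subsequence by blast
  have "(\<lambda>k. m (r (q k)) i) \<longlonglongrightarrow> l i" if "i \<in> J" for i
    using LIMSEQ_subseq_LIMSEQ[OF r(2)[rule_format, OF that] q(1)] by (simp add: o_def)
  then have "\<forall>i\<in>insert j J. (\<lambda>k. m ((r \<circ> q) k) i) \<longlonglongrightarrow> (l(j := lj)) i"
    using q(2) insert.hyps(2) by (auto simp: o_def)
  then show ?case using strict_mono_o[OF r(1) q(1)] by blast
qed

lemma accumulation_point_subseq:
  assumes "strict_mono r" "(x \<circ> r) \<longlonglongrightarrow> p"
  shows "accumulation_point x p"
  using assms unfolding accumulation_point_def by blast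

lemma accumulation_point_shift:
  assumes "accumulation_point (\<lambda>k. x (k + n)) p"
  shows "accumulation_point x p"
proof -
  obtain r where r: "strict_mono r" "((\<lambda>k. x (k + n)) \<circ> r) \<longlonglongrightarrow> p"
    using assms unfolding accumulation_point_def by blast
  show ?thesis
    by (rule accumulation_point_subseq[of "\<lambda>k. r k + n"]) (use r in \<open>auto simp: strict_mono_def o_def\<close>)
qed

lemma accumulation_point_if_frequently:
  fixes z :: "nat \<Rightarrow> 'a::metric_space"
  assumes "\<And>U. open U \<Longrightarrow> p \<in> U \<Longrightarrow> \<exists>\<^sub>F k in sequentially. z k \<in> U"
  shows "accumulation_point z p"
proof -
  have "\<exists>r. \<forall>n. dist (z (r n)) p < 1 / Suc n \<and> r n < r (Suc n)"
  proof (rule dependent_nat_choice)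
    have fr: "\<exists>\<^sub>F k in sequentially. z k \<in> ball p (1 / Suc n)" for n
      by (rule assms) auto
    show "\<exists>k. dist (z k) p < 1 / Suc 0"
      using frequently_ex[OF fr[of 0]] by (auto simp: dist_commute)
    fix k n
    show "\<exists>k'. dist (z k') p < 1 / Suc (Suc n) \<and> k < k'"
      using fr[of "Suc n"] unfolding frequently_sequentially
      by (metis mem_ball dist_commute Suc_le_lessD)
  qed
  then obtain r where r: "\<And>n. dist (z (r n)) p < 1 / Suc n" "strict_mono r"
    by (auto simp: strict_mono_Suc_iff)
  have "(\<lambda>n. dist (z (r n)) p) \<longlonglongrightarrow> 0"
    by (rule tendsto_sandwich[OF _ _ tendsto_const LIMSEQ_Suc[OF lim_1_over_n]])
       (use r(1) in \<open>auto intro: less_imp_le eventuallyI\<close>)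
  then have "(z \<circ> r) \<longlonglongrightarrow> p" by (simp add: o_def tendsto_dist_iff[symmetric])
  with r(2) show ?thesis by (rule accumulation_point_subseq)
qed

text \<open>A point that is no accumulation point has a neighbourhood which the sequence eventually
  avoids; at the other points \<open>V p\<close> is taken. In a finite subcover of the compact
  closure of the range, only sets of the second kind can contain \<open>z k\<close> for large
  \<open>k\<close>.\<close>

lemma compact_cover_accumulation_points:
  fixes z :: "nat \<Rightarrow> 'a::heine_borel"
  assumes bdd: "bounded (range z)"
    and V: "\<And>p. accumulation_point z p \<Longrightarrow> open (V p) \<and> p \<in> V p"
  shows "\<exists>P. finite P \<and> (\<forall>p\<in>P. accumulation_point z p) \<and> (\<forall>\<^sub>F k in sequentially. z k \<in> \<Union>(V ` P))"
proof -
  have "\<exists>N. open N \<and> p \<in> N \<and>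
      (if accumulation_point z p then N = V p else \<forall>\<^sub>F k in sequentially. z k \<notin> N)" for p
    using V[of p] accumulation_point_if_frequently[of p z]
    by (cases "accumulation_point z p") (auto simp: frequently_def)
  then obtain N where N: "\<And>p. open (N p)" "\<And>p. p \<in> N p"
    "\<And>p. if accumulation_point z p then N p = V p else \<forall>\<^sub>F k in sequentially. z k \<notin> N p"
    by metis
  have "compact (closure (range z))" using bdd by simp
  then obtain Q where Q: "finite Q" "closure (range z) \<subseteq> \<Union>(N ` Q)"
    using N(1,2) by (elim compactE_image[where C = "closure (range z)" and f = N]) auto
  define P where "P = {p \<in> Q. accumulation_point z p}"
  have "\<forall>\<^sub>F k in sequentially. \<forall>p\<in>Q - P. z k \<notin> N p"
    using Q(1) N(3) by (subst eventually_ball_finite_distrib) (auto simp: P_def split: if_splits)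
  then have "\<forall>\<^sub>F k in sequentially. z k \<in> \<Union>(V ` P)"
  proof eventually_elim
    case (elim k)
    have "z k \<in> closure (range z)" by (rule closure_subset[THEN subsetD]) simp
    then obtain p where p: "p \<in> Q" "z k \<in> N p" using Q(2) by auto
    then have "p \<in> P" using elim by blast
    moreover have "N p = V p" using N(3)[of p] \<open>p \<in> P\<close> by (simp add: P_def)
    ultimately show ?case using p by auto
  qed
  then show ?thesis using Q(1) by (intro exI[of _ P]) (auto simp: P_def)
qed

section \<open>Finite length under the Kurdyka--Lojasiewicz property\<close>

text \<open>The graph of a concave function lies below its tangent at \<open>s\<close>. This
  converts the KL inequality, which speaks of the derivative at the current value, into a bound by
  the decrease of \<phi> between consecutive values.\<close>

lemma concave_decrease_ge_derivative:
  fixes \<phi> :: "real \<Rightarrow> real" and a :: ereal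
  assumes "concave_on {s. 0 \<le> s \<and> ereal s < a} \<phi>"
    and "0 < s" "ereal s < a" "0 < s'" "ereal s' < a"
    and "(\<phi> has_real_derivative m) (at s)"
  shows "m * (s - s') \<le> \<phi> s - \<phi> s'"
proof -
  \<comment> \<open>Removing the endpoint 0 makes the interval open, so that \<open>s\<close> is an
    interior point as the tangent inequality requires.\<close>
  define A where "A = {s. 0 < s \<and> ereal s < a}"
  have "open A" unfolding A_def
    by (intro open_Collect_conj open_Collect_less continuous_intros continuous_on_ereal)
  have "is_interval A" unfolding is_interval_1 A_def
    by clarify (meson ereal_less_eq(3) le_less_trans less_le_trans)
  then have "convex A" by (simp add: is_interval_convex_1)
  have "convex_on A (\<lambda>s. - \<phi> s)"
    using assms(1) unfolding concave_on_def
    by (rule convex_on_subset) (use \<open>convex A\<close> in \<open>auto simp: A_def\<close>)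
  then have "- m * (s' - s) \<le> - \<phi> s' - - \<phi> s"
  proof (rule convex_on_imp_above_tangent)
    show "connected A" using \<open>convex A\<close> by (rule convex_connected)
    show "s \<in> interior A" using \<open>open A\<close> assms(2,3) by (simp add: interior_open A_def)
    show "s' \<in> A" using assms(4,5) by (simp add: A_def)
    show "((\<lambda>s. - \<phi> s) has_field_derivative - m) (at s within A)"
      using DERIV_subset[OF assms(6), of A] by (intro DERIV_minus) auto
  qed
  then show ?thesis by (simp add: algebra_simps)
qed

text \<open>A single desingularizing function for all accumulation points is the sum of the finitely many
  functions belonging to a finite cover; no convergence of \<open>z\<close> itself is needed.\<close>

lemma KL_finite_length:
  fixes h :: "'a::euclidean_space \<Rightarrow> ereal" and \<delta> :: "nat \<Rightarrow> real"
  assumes KL: "\<And>p. accumulation_point z p \<Longrightarrow> h p = ereal L0 \<and> KL_property_at h p"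
    and bdd: "bounded (range z)"
    and h: "\<And>k. h (z k) = ereal (L k)" and L: "L \<longlonglongrightarrow> L0" and gt: "\<And>k. L0 < L k"
    and dec: "\<And>k. m * (\<delta> k)\<^sup>2 \<le> L k - L (Suc k)" and m: "0 < m"
    and u: "\<And>k. u k \<in> limiting_subdiff h (z k)" "\<And>k. norm (u k) \<le> M * \<delta> k"
    and \<delta>: "\<And>k. 0 \<le> \<delta> k" and M: "0 < M"
  shows "summable \<delta>"
proof -
  \<comment> \<open>The KL data form one relation, so that threshold, neighbourhood, desingularizing
    function and derivative can be chosen simultaneously for all accumulation points.\<close>
  define Q where "Q p a U \<phi> \<phi>' \<longleftrightarrow>
        (0::ereal) < a \<and> open U \<and> p \<in> U \<and>
        concave_on {s. 0 \<le> s \<and> ereal s < a} \<phi> \<and>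
        (\<forall>s. 0 \<le> s \<and> ereal s < a \<longrightarrow> (0::real) \<le> \<phi> s) \<and>
        (\<forall>s. 0 < s \<and> ereal s < a \<longrightarrow> (\<phi> has_real_derivative \<phi>' s) (at s) \<and> 0 < \<phi>' s) \<and>
        (\<forall>x\<in>U. h p < h x \<and> h x < h p + a \<longrightarrow>
           1 \<le> ereal (\<phi>' (real_of_ereal (h x - h p))) * dist0 (limiting_subdiff h x))"
    for p a U \<phi> \<phi>'
  have "\<exists>a U \<phi> \<phi>'. Q p a U \<phi> \<phi>'" if "accumulation_point z p" for p
    using KL[OF that, THEN conjunct2] unfolding KL_property_at_def Q_def
    by (elim ex_forward) blast
  then obtain a U \<phi> \<phi>' where "\<And>p. accumulation_point z p \<Longrightarrow> Q p (a p) (U p) (\<phi> p) (\<phi>' p)"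
    by metis
  note * = this[unfolded Q_def]
  obtain P where P: "finite P" "\<And>p. p \<in> P \<Longrightarrow> accumulation_point z p"
    and cover: "\<forall>\<^sub>F k in sequentially. z k \<in> \<Union>(U ` P)"
  proof -
    have "open (U p) \<and> p \<in> U p" if "accumulation_point z p" for p
      using *[OF that] by blast
    then show ?thesis
      using compact_cover_accumulation_points[OF bdd, of U] that by blast
  qed
  define s where "s k = L k - L0" for k
  have s: "0 < s k" for k using gt by (simp add: s_def)
  have s_dec: "s (Suc k) \<le> s k" for k
  proof -
    have "0 \<le> m * (\<delta> k)\<^sup>2" using m by simp
    then show ?thesis using dec[of k] by (simp add: s_def)
  qed
  have "s \<longlonglongrightarrow> 0" unfolding s_def using L by (simp add: LIM_zero_iff)
  then have "(\<lambda>k. ereal (s k)) \<longlonglongrightarrow> 0" by (simp add: zero_ereal_def)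
  then have "\<forall>\<^sub>F k in sequentially. ereal (s k) < a p" if "p \<in> P" for p
    using *[OF P(2)[OF that]] by (auto intro: order_tendstoD)
  then have small: "\<forall>\<^sub>F k in sequentially. \<forall>p\<in>P. ereal (s k) < a p"
    using P(1) by (subst eventually_ball_finite_distrib) auto
  obtain N where N: "\<And>k. k \<ge> N \<Longrightarrow> z k \<in> \<Union>(U ` P)"
    "\<And>k p. k \<ge> N \<Longrightarrow> p \<in> P \<Longrightarrow> ereal (s k) < a p"
  proof -
    from eventually_conj[OF small cover] obtain N where
      "\<And>k. k \<ge> N \<Longrightarrow> (\<forall>p\<in>P. ereal (s k) < a p) \<and> z k \<in> \<Union>(U ` P)"
      unfolding eventually_sequentially by blast
    then show ?thesis using that[of N] by blast
  qed
  define \<Phi> where "\<Phi> k = (\<Sum>p\<in>P. \<phi> p (s k))" for k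
  have tangent: "\<phi>' p (s k) * (s k - s (Suc k)) \<le> \<phi> p (s k) - \<phi> p (s (Suc k))"
    and deriv_pos: "0 < \<phi>' p (s k)" if "k \<ge> N" "p \<in> P" for k p
  proof -
    note q = *[OF P(2)[OF that(2)]]
    show "0 < \<phi>' p (s k)" using q s N(2)[OF that] by blast
    show "\<phi>' p (s k) * (s k - s (Suc k)) \<le> \<phi> p (s k) - \<phi> p (s (Suc k))"
      by (rule concave_decrease_ge_derivative[of "a p"])
         (use q s N(2)[of _ p] that in auto)
  qed
  have mono: "\<phi> p (s (Suc k)) \<le> \<phi> p (s k)" if "k \<ge> N" "p \<in> P" for k p
  proof -
    have "0 \<le> \<phi>' p (s k) * (s k - s (Suc k))"
      using deriv_pos[OF that] s_dec[of k] by (intro mult_nonneg_nonneg) auto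
    then show ?thesis using tangent[OF that] by simp
  qed
  \<comment> \<open>The same \<open>\<delta> k\<close> controls the subgradient and, squared, the
    decrease. Multiplying the KL inequality
    \<open>1 \<le> \<phi>' p (s k) * (M * \<delta> k)\<close> by \<open>m / M * \<delta> k\<close>
    therefore leaves the step length on the left and produces the decrease on the right.\<close>
  have step: "m / M * \<delta> k \<le> \<Phi> k - \<Phi> (Suc k)" if k: "k \<ge> N" for k
  proof -
    obtain p where p: "p \<in> P" "z k \<in> U p" using N(1)[OF k] by auto
    note q = *[OF P(2)[OF p(1)]] and hp = KL[OF P(2)[OF p(1)], THEN conjunct1]
    have "h p < h (z k)" "h (z k) < h p + a p"
      using gt[of k] N(2)[OF k p(1)] by (auto simp: h hp s_def) (cases "a p"; simp)
    then have "1 \<le> ereal (\<phi>' p (s k)) * dist0 (limiting_subdiff h (z k))"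
      using q p(2) by (auto simp: h hp s_def)
    also have "\<dots> \<le> ereal (\<phi>' p (s k)) * ereal (norm (u k))"
      using deriv_pos[OF k p(1)] u(1)[of k] unfolding dist0_def
      by (intro ereal_mult_left_mono INF_lower) auto
    finally have "1 \<le> \<phi>' p (s k) * norm (u k)" by (simp add: one_ereal_def)
    also have "\<dots> \<le> \<phi>' p (s k) * (M * \<delta> k)"
      using deriv_pos[OF k p(1)] u(2) by (intro mult_left_mono) auto
    finally have 1: "1 \<le> \<phi>' p (s k) * (M * \<delta> k)" .
    have "m / M * \<delta> k * 1 \<le> m / M * \<delta> k * (\<phi>' p (s k) * (M * \<delta> k))"
      using 1 m M \<delta>[of k] by (intro mult_left_mono) auto
    also have "\<dots> = \<phi>' p (s k) * (m * (\<delta> k)\<^sup>2)" using M by (simp add: power2_eq_square)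
    also have "\<dots> \<le> \<phi>' p (s k) * (s k - s (Suc k))"
      using deriv_pos[OF k p(1)] dec[of k] by (intro mult_left_mono) (auto simp: s_def)
    also have "\<dots> \<le> \<phi> p (s k) - \<phi> p (s (Suc k))" by (rule tangent[OF k p(1)])
    \<comment> \<open>Every summand is nonnegative by \<open>mono\<close>, so it does not matter
      which \<open>p\<close> covers \<open>z k\<close>; the bound telescopes although
      \<open>p\<close> varies with \<open>k\<close>.\<close>
    also have "\<dots> \<le> (\<Sum>p\<in>P. \<phi> p (s k) - \<phi> p (s (Suc k)))"
      using mono[OF k] P(1) p(1) by (intro member_le_sum) auto
    finally show ?thesis by (simp add: \<Phi>_def sum_subtractf)
  qed
  have \<Phi>_pos: "0 \<le> \<Phi> k" if "k \<ge> N" for k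
    unfolding \<Phi>_def
  proof (rule sum_nonneg)
    fix p assume p: "p \<in> P"
    show "0 \<le> \<phi> p (s k)" using *[OF P(2)[OF p]] less_imp_le[OF s] N(2)[OF that p] by blast
  qed
  have "summable (\<lambda>k. m / M * \<delta> (k + N))"
  proof (rule summableI_nonneg_bounded)
    show "0 \<le> m / M * \<delta> (k + N)" for k using m M \<delta> by simp
    show "(\<Sum>k<n. m / M * \<delta> (k + N)) \<le> \<Phi> N" for n
    proof -
      have "(\<Sum>k<n. m / M * \<delta> (k + N)) \<le> (\<Sum>k<n. \<Phi> (k + N) - \<Phi> (Suc k + N))"
        by (intro sum_mono) (use step in auto)
      also have "\<dots> = \<Phi> N - \<Phi> (n + N)"
        by (subst sum_lessThan_telescope') simp
      finally show ?thesis using \<Phi>_pos[of "n + N"] by simp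
    qed
  qed
  then have "summable (\<lambda>k. \<delta> (k + N))"
    using m M by (simp add: summable_cmult_iff)
  then show ?thesis by (simp add: summable_iff_shift)
qed

section \<open>Constraints and multipliers\<close>

lemma GDERIV_affine:
  fixes a :: "'a::real_inner"
  shows "GDERIV (\<lambda>z. a \<bullet> z + \<beta>) x :> a"
  unfolding gderiv_def by (auto intro!: derivative_eq_intros simp: inner_commute)

lemma grad_affine:
  fixes h :: "'a::euclidean_space \<Rightarrow> real"
  assumes "\<And>z. h z = a \<bullet> z + \<beta>"
  shows "grad h x = a"
proof -
  have h: "h = (\<lambda>z. a \<bullet> z + \<beta>)" using assms by auto
  have "D = a" if "GDERIV (\<lambda>z. a \<bullet> z + \<beta>) x :> D" for D
  proof -
    have "(\<lambda>h. h \<bullet> D) = (\<lambda>h. h \<bullet> a)"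
      using that GDERIV_affine[of a \<beta> x] unfolding gderiv_def
      by (rule has_derivative_unique)
    then show "D = a" by (metis inner_commute vector_eq_rdot)
  qed
  then show ?thesis
    unfolding grad_def h by (intro the_equality GDERIV_affine)
qed

text \<open>Pairing the vanishing combination with the MFCQ direction \<open>w\<close> removes the
  equality terms and leaves a sum of nonnegative terms, which kills the inequality multipliers.
  Linear independence then kills the rest.\<close>

lemma MFCQ_multiplier_zero:
  assumes fin: "finite E" "finite I" "E \<inter> I = {}" and mfcq: "MFCQ E I c p"
    and sum0: "(\<Sum>i\<in>E \<union> I. \<mu> i *\<^sub>R grad (c i) p) = 0"
    and pos: "\<And>i. i \<in> I \<Longrightarrow> 0 \<le> \<mu> i"
    and act: "\<And>i. i \<in> I \<Longrightarrow> 0 < \<mu> i \<Longrightarrow> c i p = 0"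
    and i: "i \<in> E \<union> I"
  shows "\<mu> i = 0"
proof -
  obtain w where w: "\<And>i. i \<in> I \<Longrightarrow> c i p = 0 \<Longrightarrow> 0 < grad (c i) p \<bullet> w"
      "\<And>i. i \<in> E \<Longrightarrow> grad (c i) p \<bullet> w = 0"
    and inj: "inj_on (\<lambda>i. grad (c i) p) E" and ind: "independent ((\<lambda>i. grad (c i) p) ` E)"
    using mfcq unfolding MFCQ_def by auto
  have "0 = (\<Sum>i\<in>E \<union> I. \<mu> i *\<^sub>R grad (c i) p) \<bullet> w" using sum0 by simp
  also have "\<dots> = (\<Sum>i\<in>E \<union> I. \<mu> i * (grad (c i) p \<bullet> w))"
    by (simp add: inner_sum_left)
  also have "\<dots> = (\<Sum>i\<in>I. \<mu> i * (grad (c i) p \<bullet> w))"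
    using fin w(2) by (simp add: sum.union_disjoint)
  finally have "(\<Sum>i\<in>I. \<mu> i * (grad (c i) p \<bullet> w)) = 0" ..
  moreover have term_nonneg: "0 \<le> \<mu> i * (grad (c i) p \<bullet> w)" if "i \<in> I" for i
    using pos[OF that] act[OF that] w(1)[OF that] by (cases "\<mu> i = 0") auto
  ultimately have zero: "\<mu> i * (grad (c i) p \<bullet> w) = 0" if "i \<in> I" for i
    using that fin(2) by (simp add: sum_nonneg_eq_0_iff)
  have I0: "\<mu> i = 0" if "i \<in> I" for i
  proof (rule ccontr)
    assume "\<mu> i \<noteq> 0"
    then have "0 < \<mu> i" using pos[OF that] by simp
    then have "0 < grad (c i) p \<bullet> w" using w(1) act that by blast
    with zero[OF that] \<open>0 < \<mu> i\<close> show False by simp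
  qed
  have sumE: "(\<Sum>i\<in>E. \<mu> i *\<^sub>R grad (c i) p) = 0"
    using sum0 fin I0 by (simp add: sum.union_disjoint)
  \<comment> \<open>Independence concerns the set of gradients, the combination is indexed by
    \<open>E\<close>. Injectivity transports the coefficients from the indices to the
    vectors.\<close>
  define G where "G i = grad (c i) p" for i
  have inj_G: "inj_on G E" and ind_G: "independent (G ` E)"
    using inj ind by (simp_all add: G_def[abs_def])
  have "(\<Sum>y\<in>G ` E. \<mu> (the_inv_into E G y) *\<^sub>R y) = 0"
    using sumE by (simp add: sum.reindex[OF inj_G] the_inv_into_f_f[OF inj_G] G_def[symmetric])
  then have "\<mu> (the_inv_into E G (G i)) = 0" if "i \<in> E" for i
    using independentD[OF ind_G finite_imageI[OF fin(1)] subset_refl,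
        of "\<lambda>y. \<mu> (the_inv_into E G y)" "G i"] that by blast
  then have "\<mu> i = 0" if "i \<in> E" for i using that by (simp add: the_inv_into_f_f[OF inj_G])
  with I0 i show ?thesis by blast
qed

lemma unbounded_subseq:
  fixes N :: "nat \<Rightarrow> real"
  assumes "\<nexists>B. \<forall>k. N k \<le> B"
  shows "\<exists>r. strict_mono r \<and> (\<forall>n. real n < N (r n))"
proof -
  have large: "\<exists>k>m. B < N k" for B m
  proof (rule ccontr)
    assume "\<not> (\<exists>k>m. B < N k)"
    then have "N k \<le> max B (Max (N ` {..m}))" for k
      by (cases "k \<le> m") (auto simp: le_max_iff_disj not_le)
    with assms show False by blast
  qed
  have "\<exists>r. \<forall>n. real n < N (r n) \<and> r n < r (Suc n)"
  proof (rule dependent_nat_choice)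
    show "\<exists>k. real 0 < N k" using large[of 0 0] by auto
    show "\<exists>k'. real (Suc n) < N k' \<and> k < k'" for k n using large[of k "real (Suc n)"] by blast
  qed
  then show ?thesis by (auto simp: strict_mono_Suc_iff)
qed

lemma norm_matrix_vector_mult_bound:
  fixes B :: "'k \<Rightarrow> real^'n^'m"
  assumes "bounded (range B)"
  shows "\<exists>M>0. \<forall>k v. norm (B k *v v) \<le> M * norm v"
proof -
  obtain M where M: "\<And>k. norm (B k) \<le> M" "0 < M"
    using assms by (auto simp: bounded_pos)
  \<comment> \<open>The operator norm is at most the number of entries times a bound on each entry,
    and every entry is bounded by the norm of the matrix.\<close>
  let ?M = "real CARD('m) * real CARD('n) * M"
  have "norm (B k *v v) \<le> ?M * norm v" for k v
  proof -
    have "\<bar>B k $ i $ j\<bar> \<le> M" for i j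
      using component_le_norm_cart[of "B k $ i" j] Finite_Cartesian_Product.norm_nth_le[of "B k" i]
        M(1)[of k] by linarith
    then have "onorm ((*v) (B k)) \<le> ?M" by (rule onorm_le_matrix_component)
    moreover have "norm (B k *v v) \<le> onorm ((*v) (B k)) * norm v"
      by (rule onorm[OF matrix_vector_mul_bounded_linear])
    ultimately show ?thesis by (meson mult_right_mono norm_ge_zero order_trans)
  qed
  then show ?thesis using M(2) by (intro exI[of _ ?M]) simp
qed

text \<open>Otherwise the normalized multipliers would converge, along a subsequence, to a nonzero
  multiplier annihilating the active gradients at an accumulation point, against MFCQ.\<close>

lemma multipliers_bounded:
  fixes c :: "'i \<Rightarrow> 'a::euclidean_space \<Rightarrow> real"
  assumes fin: "finite E" "finite I" "E \<inter> I = {}"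
    and bdd: "bounded (range z)" and mfcq: "\<And>p. accumulation_point z p \<Longrightarrow> MFCQ E I c p"
    and cont: "\<And>i. i \<in> E \<union> I \<Longrightarrow> continuous_on UNIV (c i) \<and> continuous_on UNIV (grad (c i))"
    and comb: "\<And>k. norm (\<Sum>i\<in>E \<union> I. \<mu> k i *\<^sub>R grad (c i) (z k)) \<le> M"
    and pos: "\<And>k i. i \<in> I \<Longrightarrow> 0 \<le> \<mu> k i"
    and act: "\<And>k i. i \<in> I \<Longrightarrow> 0 < \<mu> k i \<Longrightarrow> c i (z k) \<le> 0"
  shows "\<exists>B. \<forall>k. \<forall>i\<in>E \<union> I. \<bar>\<mu> k i\<bar> \<le> B"
proof (rule ccontr)
  assume unb: "\<nexists>B. \<forall>k. \<forall>i\<in>E \<union> I. \<bar>\<mu> k i\<bar> \<le> B"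
  \<comment> \<open>The normalizer is the 1-norm over all indices: normalized multipliers have total
    absolute value 1, which contradicts the zero limit found at the end.\<close>
  define N where "N k = (\<Sum>i\<in>E \<union> I. \<bar>\<mu> k i\<bar>)" for k
  have finJ: "finite (E \<union> I)" using fin by simp
  have le_N: "\<bar>\<mu> k i\<bar> \<le> N k" if "i \<in> E \<union> I" for k i
    unfolding N_def using finJ that by (intro member_le_sum) auto
  have "\<nexists>B. \<forall>k. N k \<le> B"
  proof
    assume "\<exists>B. \<forall>k. N k \<le> B"
    then obtain B where "\<And>k. N k \<le> B" by blast
    then have "\<forall>k. \<forall>i\<in>E \<union> I. \<bar>\<mu> k i\<bar> \<le> B" by (blast intro: order_trans[OF le_N])
    with unb show False by blast
  qed
  then obtain r where r: "strict_mono r" "\<And>n. real n < N (r n)"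
    using unbounded_subseq by blast
  have N_pos: "0 < N (r n)" for n using r(2)[of n] of_nat_0_le_iff le_less_trans by blast
  have "bounded (range (z \<circ> r))" by (rule bounded_subset[OF bdd]) auto
  then obtain q p where q: "strict_mono q" "((z \<circ> r) \<circ> q) \<longlonglongrightarrow> p"
    using bounded_imp_convergent_subsequence by blast
  have "bounded (range (\<lambda>k. \<mu> (r (q k)) i / N (r (q k))))" if "i \<in> E \<union> I" for i
    by (rule boundedI[of _ 1]) (use le_N[OF that] N_pos in \<open>auto simp: abs_of_pos\<close>)
  then obtain s \<nu> where s: "strict_mono s"
    "\<And>i. i \<in> E \<union> I \<Longrightarrow> (\<lambda>k. \<mu> (r (q (s k))) i / N (r (q (s k)))) \<longlonglongrightarrow> \<nu> i"
    using bounded_family_convergent_subseq[OF finJ, of "\<lambda>k i. \<mu> (r (q k)) i / N (r (q k))"] by blast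
  define j where "j k = r (q (s k))" for k
  have j: "strict_mono j" using r(1) q(1) s(1) by (auto simp: j_def strict_mono_def)
  have z: "(\<lambda>k. z (j k)) \<longlonglongrightarrow> p"
    using LIMSEQ_subseq_LIMSEQ[OF q(2) s(1)] by (simp add: j_def comp_def)
  have \<nu>: "(\<lambda>k. \<mu> (j k) i / N (j k)) \<longlonglongrightarrow> \<nu> i" if "i \<in> E \<union> I" for i
    using s(2)[OF that] by (simp add: j_def)
  have "accumulation_point z p" using j z by (auto simp: accumulation_point_def comp_def)
  then have mfcq_p: "MFCQ E I c p" by (rule mfcq)
  have No: "0 < N (j k)" for k using N_pos by (simp add: j_def)
  have ko: "real k < N (j k)" for k
  proof -
    have "k \<le> q (s k)"
      using order_trans[OF seq_suble[OF s(1)] seq_suble[OF q(1)]] .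
    then show ?thesis using r(2)[of "q (s k)"] by (simp add: j_def)
  qed
  have c_lim: "(\<lambda>k. c i (z (j k))) \<longlonglongrightarrow> c i p"
    "(\<lambda>k. grad (c i) (z (j k))) \<longlonglongrightarrow> grad (c i) p" if "i \<in> E \<union> I" for i
  proof -
    have "isCont (c i) p" "isCont (grad (c i)) p"
      using cont[OF that] by (simp_all add: continuous_on_eq_continuous_at)
    then show "(\<lambda>k. c i (z (j k))) \<longlonglongrightarrow> c i p" "(\<lambda>k. grad (c i) (z (j k))) \<longlonglongrightarrow> grad (c i) p"
      using z by (auto intro: isCont_tendsto_compose)
  qed
  have "(\<lambda>k. \<Sum>i\<in>E \<union> I. (\<mu> (j k) i / N (j k)) *\<^sub>R grad (c i) (z (j k)))
      \<longlonglongrightarrow> (\<Sum>i\<in>E \<union> I. \<nu> i *\<^sub>R grad (c i) p)"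
    by (intro tendsto_intros \<nu> c_lim)
  moreover have "(\<lambda>k. \<Sum>i\<in>E \<union> I. (\<mu> (j k) i / N (j k)) *\<^sub>R grad (c i) (z (j k))) \<longlonglongrightarrow> 0"
  proof (rule Lim_null_comparison)
    have "(\<Sum>i\<in>E \<union> I. (\<mu> (j k) i / N (j k)) *\<^sub>R grad (c i) (z (j k)))
        = (1 / N (j k)) *\<^sub>R (\<Sum>i\<in>E \<union> I. \<mu> (j k) i *\<^sub>R grad (c i) (z (j k)))" for k
      by (simp add: scaleR_sum_right)
    then have "norm (\<Sum>i\<in>E \<union> I. (\<mu> (j k) i / N (j k)) *\<^sub>R grad (c i) (z (j k))) \<le> M / N (j k)" for k
      using comb[of "j k"] No[of k] by (simp add: divide_right_mono)
    also have "M / N (j k) \<le> M / real k" if "k > 0" for k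
      using ko[of k] that norm_ge_zero[THEN order_trans, OF comb]
      by (intro divide_left_mono) auto
    finally show "\<forall>\<^sub>F k in sequentially. norm (\<Sum>i\<in>E \<union> I. (\<mu> (j k) i / N (j k)) *\<^sub>R grad (c i) (z (j k))) \<le> M / real k"
      by (rule eventually_mono[OF eventually_gt_at_top[of 0]])
    show "(\<lambda>k. M / real k) \<longlonglongrightarrow> 0" by (rule lim_const_over_n)
  qed
  ultimately have sum0: "(\<Sum>i\<in>E \<union> I. \<nu> i *\<^sub>R grad (c i) p) = 0"
    by (rule LIMSEQ_unique)
  have \<nu>_pos: "0 \<le> \<nu> i" if "i \<in> I" for i
    by (rule LIMSEQ_le_const[OF \<nu>]) (use that pos No in \<open>auto simp: less_imp_le\<close>)
  have \<nu>_act: "c i p = 0" if i: "i \<in> I" "0 < \<nu> i" for i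
  proof -
    have "\<forall>\<^sub>F k in sequentially. 0 < \<mu> (j k) i / N (j k)"
      using order_tendstoD(1)[OF \<nu> i(2)] i(1) by simp
    then have "\<forall>\<^sub>F k in sequentially. c i (z (j k)) \<le> 0"
    proof eventually_elim
      case (elim k)
      then have "0 < \<mu> (j k) i" using No[of k] by (simp add: zero_less_divide_iff)
      then show ?case by (rule act[OF i(1)])
    qed
    \<comment> \<open>A positive limit multiplier forces a nonpositive constraint value; feasibility
      of \<open>p\<close>, contained in MFCQ, supplies the opposite inequality.\<close>
    then have "c i p \<le> 0"
      using c_lim(1)[of i] i(1) by (intro tendsto_upperbound[OF _ _ sequentially_bot]) auto
    then show ?thesis using mfcq_p i(1) by (force simp: MFCQ_def feasible_set_def)
  qed
  have "\<nu> i = 0" if "i \<in> E \<union> I" for i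
    by (rule MFCQ_multiplier_zero[OF fin mfcq_p sum0 \<nu>_pos \<nu>_act that])
  then have "(\<lambda>k. \<Sum>i\<in>E \<union> I. \<bar>\<mu> (j k) i / N (j k)\<bar>) \<longlonglongrightarrow> (\<Sum>i\<in>E \<union> I. \<bar>0\<bar>)"
    using \<nu> by (intro tendsto_sum tendsto_rabs) fastforce
  moreover have "(\<Sum>i\<in>E \<union> I. \<bar>\<mu> (j k) i / N (j k)\<bar>) = 1" for k
    using No[of k] by (simp add: abs_divide sum_divide_distrib[symmetric] N_def[symmetric])
  ultimately show False by (simp add: LIMSEQ_const_iff)
qed

text \<open>Complementarity makes \<open>lam i\<close> equal to \<open>\<plusminus>\<theta>\<close> wherever the linearized constraint \<open>i\<close> is
  violated, so the multipliers measure the linearized violation exactly.\<close>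

lemma qp_multiplier_slope:
  assumes fin: "finite E" "finite I" "E \<inter> I = {}" and \<theta>: "0 < \<theta>"
    and feas: "qp_feasible E I c x d v w t"
    and mult: "qp_multiplier E I c x \<theta> g B d v w t lam"
  shows "g \<bullet> d \<le> - (d \<bullet> (B *v d)) + \<theta> * violation E I c x
     - \<theta> * ((\<Sum>i\<in>E. \<bar>c i x + grad (c i) x \<bullet> d\<bar>) + (\<Sum>i\<in>I. max 0 (- (c i x + grad (c i) x \<bullet> d))))"
proof -
  obtain p q r where
    stat: "g + B *v d - (\<Sum>i\<in>E \<union> I. lam i *\<^sub>R grad (c i) x) = 0"
    and mI: "\<forall>i\<in>I. 0 \<le> lam i \<and> lam i * (c i x + grad (c i) x \<bullet> d + t i) = 0"
    and mE: "\<forall>i\<in>E. 0 \<le> p i \<and> 0 \<le> q i \<and> \<theta> + lam i = p i \<and> \<theta> - lam i = q i \<and>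
           p i * v i = 0 \<and> q i * w i = 0"
    and mR: "\<forall>i\<in>I. 0 \<le> r i \<and> \<theta> - lam i = r i \<and> r i * t i = 0"
    using mult unfolding qp_multiplier_def by (elim exE conjE)
  have E: "\<bar>lam i\<bar> \<le> \<theta>" "(\<theta> + lam i) * v i = 0" "(\<theta> - lam i) * w i = 0" if i: "i \<in> E" for i
  proof -
    from bspec[OF mE i] have pq: "0 \<le> p i" "0 \<le> q i" "\<theta> + lam i = p i" "\<theta> - lam i = q i"
      "p i * v i = 0" "q i * w i = 0" by blast+
    show "\<bar>lam i\<bar> \<le> \<theta>" using pq(1-4) by linarith
    show "(\<theta> + lam i) * v i = 0" "(\<theta> - lam i) * w i = 0" by (simp_all only: pq)
  qed
  have I: "0 \<le> lam i" "lam i \<le> \<theta>" "lam i * (c i x + grad (c i) x \<bullet> d + t i) = 0"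
      "(\<theta> - lam i) * t i = 0" if i: "i \<in> I" for i
  proof -
    from bspec[OF mR i] have r: "0 \<le> r i" "\<theta> - lam i = r i" "r i * t i = 0" by blast+
    show "lam i \<le> \<theta>" using r(1,2) by linarith
    show "(\<theta> - lam i) * t i = 0" by (simp only: r)
    from bspec[OF mI i] show "0 \<le> lam i" "lam i * (c i x + grad (c i) x \<bullet> d + t i) = 0" by blast+
  qed
  have E_le: "lam i * (grad (c i) x \<bullet> d) \<le> \<theta> * \<bar>c i x\<bar> - \<theta> * \<bar>c i x + grad (c i) x \<bullet> d\<bar>"
    if i: "i \<in> E" for i
  proof -
    have F: "c i x + grad (c i) x \<bullet> d = v i - w i" "0 \<le> v i" "0 \<le> w i"
      using feas i by (auto simp: qp_feasible_def)
    have "lam i * (v i - w i) = - (\<theta> * (v i + w i))"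
    proof -
      have "\<theta> * v i + lam i * v i = 0" "\<theta> * w i - lam i * w i = 0"
        using E(2,3)[OF i] unfolding distrib_right left_diff_distrib .
      then show ?thesis unfolding distrib_left right_diff_distrib by linarith
    qed
    also have "\<dots> \<le> - (\<theta> * \<bar>v i - w i\<bar>)" using F(2,3) \<theta> by simp
    finally have 1: "lam i * (c i x + grad (c i) x \<bullet> d) \<le> - (\<theta> * \<bar>c i x + grad (c i) x \<bullet> d\<bar>)"
      by (simp add: F(1))
    have "- (lam i * c i x) \<le> \<bar>lam i\<bar> * \<bar>c i x\<bar>" by (metis abs_ge_minus_self abs_mult)
    also have "\<dots> \<le> \<theta> * \<bar>c i x\<bar>" using E(1)[OF i] by (rule mult_right_mono) simp
    finally show ?thesis using 1 unfolding distrib_left by linarith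
  qed
  have I_le: "lam i * (grad (c i) x \<bullet> d)
      \<le> \<theta> * max 0 (- c i x) - \<theta> * max 0 (- (c i x + grad (c i) x \<bullet> d))"
    if i: "i \<in> I" for i
  proof -
    have F: "max 0 (- (c i x + grad (c i) x \<bullet> d)) \<le> t i"
      using feas i by (auto simp: qp_feasible_def)
    \<comment> \<open>The two complementarity conditions combine: \<open>lam i\<close> can be
      nonzero only where the linearized value is \<open>- t i\<close>, and \<open>t i\<close> can be
      nonzero only where \<open>lam i\<close> is \<theta>.\<close>
    have "lam i * (c i x + grad (c i) x \<bullet> d) = - (\<theta> * t i)"
    proof -
      show ?thesis using I(3,4)[OF i] unfolding distrib_left left_diff_distrib by linarith
    qed
    also have "\<dots> \<le> - (\<theta> * max 0 (- (c i x + grad (c i) x \<bullet> d)))"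
      using mult_left_mono[OF F less_imp_le[OF \<theta>]] by linarith
    finally have 1: "lam i * (c i x + grad (c i) x \<bullet> d)
      \<le> - (\<theta> * max 0 (- (c i x + grad (c i) x \<bullet> d)))" .
    have "- (lam i * c i x) = lam i * (- c i x)" by simp
    also have "\<dots> \<le> lam i * max 0 (- c i x)" using I(1)[OF i] by (rule mult_left_mono[rotated]) simp
    also have "\<dots> \<le> \<theta> * max 0 (- c i x)" using I(2)[OF i] by (rule mult_right_mono) simp
    finally show ?thesis using 1 unfolding distrib_left by linarith
  qed
  have "g = (\<Sum>i\<in>E \<union> I. lam i *\<^sub>R grad (c i) x) - B *v d" using stat by (simp only: right_minus_eq eq_diff_eq)
  then have gd: "g \<bullet> d = (\<Sum>i\<in>E \<union> I. lam i * (grad (c i) x \<bullet> d)) - d \<bullet> (B *v d)"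
    by (simp only: inner_diff_left inner_sum_left inner_scaleR_left inner_commute[of "B *v d" d])
  have "(\<Sum>i\<in>E \<union> I. lam i * (grad (c i) x \<bullet> d))
     = (\<Sum>i\<in>E. lam i * (grad (c i) x \<bullet> d)) + (\<Sum>i\<in>I. lam i * (grad (c i) x \<bullet> d))"
    using fin by (simp add: sum.union_disjoint)
  also have "\<dots> \<le> (\<Sum>i\<in>E. \<theta> * \<bar>c i x\<bar> - \<theta> * \<bar>c i x + grad (c i) x \<bullet> d\<bar>)
     + (\<Sum>i\<in>I. \<theta> * max 0 (- c i x) - \<theta> * max 0 (- (c i x + grad (c i) x \<bullet> d)))"
    by (intro add_mono sum_mono E_le I_le)
  also have "\<dots> = \<theta> * violation E I c x - \<theta> * ((\<Sum>i\<in>E. \<bar>c i x + grad (c i) x \<bullet> d\<bar>)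
     + (\<Sum>i\<in>I. max 0 (- (c i x + grad (c i) x \<bullet> d))))"
    unfolding violation_def sum_subtractf sum_distrib_left[symmetric] distrib_left by simp
  finally show ?thesis using gd by linarith
qed

section \<open>The potential function for affine constraints\<close>

text \<open>An affine function is its own linearization at any point, so the indicator term of the
  potential does not depend on \<open>w\<close>.\<close>

lemma linearized_set_affine:
  assumes "\<And>i. i \<in> E \<union> I \<Longrightarrow> \<forall>z. c i z = a i \<bullet> z + \<beta> i \<and> grad (c i) z = a i"
  shows "linearized_set E I c = feasible_set E I c \<times> UNIV"
proof -
  have "c i w + grad (c i) w \<bullet> (x - w) = c i x" if "i \<in> E \<union> I" for i x w
    using assms[OF that] by (simp add: inner_diff_right)
  then show ?thesis by (auto simp: linearized_set_def feasible_set_def)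
qed

lemma conjugate_pot_F_ge:
  assumes "x \<in> D" "f x = ereal r"
  shows "ereal (y \<bullet> x + r - 1/2 * \<sigma> * (norm x)\<^sup>2) \<le> conjugate (pot_F f D \<sigma>) y"
  unfolding conjugate_def
  by (rule SUP_upper2[of x]) (use assms in \<open>auto simp: pot_F_def\<close>)

text \<open>\<open>\<sigma> *\<^sub>R x - s\<close> is a subgradient of the convex function \<open>pot_F f D \<sigma>\<close> at \<open>x\<close>, so this is the
  equality case of the Fenchel--Young inequality.\<close>

lemma conjugate_pot_F_eq:
  fixes x :: "'a::euclidean_space"
  assumes x: "x \<in> D" and fin: "\<And>z. z \<in> D \<Longrightarrow> f z = ereal (fr z)"
    and sub: "\<And>z. z \<in> D \<Longrightarrow> fr z - fr x - s \<bullet> (z - x) \<le> \<sigma> / 2 * (norm (z - x))\<^sup>2"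
  shows "conjugate (pot_F f D \<sigma>) (\<sigma> *\<^sub>R x - s)
    = ereal ((\<sigma> *\<^sub>R x - s) \<bullet> x + fr x - 1/2 * \<sigma> * (norm x)\<^sup>2)"
proof (rule antisym)
  show "conjugate (pot_F f D \<sigma>) (\<sigma> *\<^sub>R x - s)
    \<le> ereal ((\<sigma> *\<^sub>R x - s) \<bullet> x + fr x - 1/2 * \<sigma> * (norm x)\<^sup>2)"
    unfolding conjugate_def
  proof (rule SUP_least)
    fix z
    show "ereal ((\<sigma> *\<^sub>R x - s) \<bullet> z) - pot_F f D \<sigma> z
      \<le> ereal ((\<sigma> *\<^sub>R x - s) \<bullet> x + fr x - 1/2 * \<sigma> * (norm x)\<^sup>2)"
    proof (cases "z \<in> D")
      case True
      have "\<sigma> / 2 * (norm (z - x))\<^sup>2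
        = \<sigma> / 2 * (norm z)\<^sup>2 - \<sigma> * (x \<bullet> z) + \<sigma> / 2 * (norm x)\<^sup>2"
        by (simp add: power2_norm_eq_inner inner_diff_left inner_diff_right inner_commute
            algebra_simps)
      then have "(\<sigma> *\<^sub>R x - s) \<bullet> z - (- fr z + 1/2 * \<sigma> * (norm z)\<^sup>2)
          \<le> (\<sigma> *\<^sub>R x - s) \<bullet> x + fr x - 1/2 * \<sigma> * (norm x)\<^sup>2"
        using sub[OF True]
        by (simp add: inner_diff_left inner_diff_right power2_norm_eq_inner)
      then show ?thesis using True fin[OF True] by (simp add: pot_F_def)
    qed (simp add: pot_F_def)
  qed
qed (use conjugate_pot_F_ge[of x D f, OF x fin[OF x]] in blast)

locale affine_problem =
  fixes E I :: "'i set" and c :: "'i \<Rightarrow> 'a::euclidean_space \<Rightarrow> real" and a \<beta>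
    and f :: "'a \<Rightarrow> ereal" and fr :: "'a \<Rightarrow> real" and D and \<sigma> l :: real
  assumes aff: "\<And>i. i \<in> E \<union> I \<Longrightarrow> \<forall>z. c i z = a i \<bullet> z + \<beta> i \<and> grad (c i) z = a i"
    and fin: "\<And>z. z \<in> D \<Longrightarrow> f z = ereal (fr z)"
    and l: "0 \<le> l" and \<sigma>: "0 \<le> \<sigma>"
begin

text \<open>For \<open>x\<close> in \<open>D\<close> this says that
  \<open>\<sigma> *\<^sub>R x - s\<close> is a convex subgradient of
  \<open>pot_F f D \<sigma>\<close> at \<open>x\<close>, expressed with real numbers only. The
  inequality in (A1) and \<rho> \<le> \<sigma> provide it for Clarke subgradients
  \<open>s\<close>.\<close>

abbreviation upper_subgradient :: "'a \<Rightarrow> 'a \<Rightarrow> bool" where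
  "upper_subgradient x s \<equiv>
     (\<forall>z\<in>D. fr z - fr x - s \<bullet> (z - x) \<le> \<sigma> / 2 * (norm (z - x))\<^sup>2)"

text \<open>With the conjugate known by equality, the mixed terms
  \<open>\<sigma> * (x \<bullet> d)\<close> cancel, and a quadratic upper model of \<open>fr\<close>
  along \<open>d\<close> plus the proximal term remains.\<close>

lemma potential_eq:
  assumes "x \<in> D" "upper_subgradient x s" "x + d \<in> feasible_set E I c"
  shows "potential E I c f D \<sigma> l (x + d, \<sigma> *\<^sub>R x - s, x)
    = ereal (fr x + s \<bullet> d + (\<sigma> + l) / 2 * (norm d)\<^sup>2)"
proof -
  have "- ((\<sigma> *\<^sub>R x - s) \<bullet> (x + d)) + ((\<sigma> *\<^sub>R x - s) \<bullet> x + fr x - 1/2 * \<sigma> * (norm x)\<^sup>2)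
      + 1/2 * \<sigma> * (norm (x + d))\<^sup>2 + 1/2 * l * (norm d)\<^sup>2
    = fr x + s \<bullet> d + (\<sigma> + l) / 2 * (norm d)\<^sup>2"
    unfolding power2_norm_eq_inner inner_diff_left inner_add_left inner_add_right inner_scaleR_left
      inner_commute[of x d]
    by (simp add: field_simps)
  moreover have "(x + d, x) \<in> linearized_set E I c"
    using assms(3) linearized_set_affine[of E I c a \<beta>, OF aff] by simp
  ultimately show ?thesis
    using conjugate_pot_F_eq[OF assms(1) fin, where \<sigma> = \<sigma> and s = s] assms(2)
    by (simp add: potential_def indicator_inf_def)
qed

text \<open>Away from the base point the conjugate has no closed form. Keeping one competitor in its
  supremum and dropping the indicator gives a real-valued minorant, which is enough for a Frechet
  subgradient inequality.\<close>

lemma potential_ge: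
  assumes "x \<in> D"
  shows "ereal (- (y \<bullet> z) + (y \<bullet> x + fr x - 1/2 * \<sigma> * (norm x)\<^sup>2)
      + 1/2 * \<sigma> * (norm z)\<^sup>2 + 1/2 * l * (norm (z - w))\<^sup>2)
    \<le> potential E I c f D \<sigma> l (z, y, w)"
proof -
  have "ereal (- (y \<bullet> z)) + ereal (y \<bullet> x + fr x - 1/2 * \<sigma> * (norm x)\<^sup>2)
      + ereal (1/2 * \<sigma> * (norm z)\<^sup>2) + ereal (1/2 * l * (norm (z - w))\<^sup>2) + 0
    \<le> potential E I c f D \<sigma> l (z, y, w)"
    unfolding potential_def prod.case
    by (intro add_mono conjugate_pot_F_ge assms fin order_refl) (simp add: indicator_inf_def)
  then show ?thesis by simp
qed

lemma potential_infinite: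
  assumes "x \<in> D" "z \<notin> feasible_set E I c"
  shows "potential E I c f D \<sigma> l (z, y, w) = \<infinity>"
proof -
  have "(z, w) \<notin> linearized_set E I c"
    using assms(2) linearized_set_affine[of E I c a \<beta>, OF aff] by simp
  moreover have "conjugate (pot_F f D \<sigma>) y \<noteq> - \<infinity>"
    using conjugate_pot_F_ge[of x D f "fr x" y \<sigma>] fin assms(1) by auto
  ultimately show ?thesis by (simp add: potential_def indicator_inf_def)
qed

text \<open>The bilinear term \<open>- y \<bullet> x\<close> is the only nonconvex one and of second order, so the product of the
  convex subdifferentials of the other terms is contained in the regular subdifferential. The vector
  \<open>- (s + q)\<close> is a normal of the feasible set at \<open>x + d\<close>.\<close>

lemma potential_regular_subgradient:
  assumes x: "x \<in> D" and s: "upper_subgradient x s" and xd: "x + d \<in> feasible_set E I c"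
    and normal: "\<And>z. z \<in> feasible_set E I c \<Longrightarrow> 0 \<le> (s + q) \<bullet> (z - (x + d))"
  shows "((\<sigma> + l) *\<^sub>R d - q, - d, - l *\<^sub>R d)
    \<in> regular_subdiff (potential E I c f D \<sigma> l) (x + d, \<sigma> *\<^sub>R x - s, x)"
    (is "?u \<in> regular_subdiff ?L ?p")
  unfolding regular_subdiff_def
proof (intro CollectI conjI allI impI)
  note Lp = potential_eq[OF x s xd]
  show "\<bar>?L ?p\<bar> \<noteq> \<infinity>" by (simp add: Lp)
  fix e :: real assume e: "0 < e"
  \<comment> \<open>Radius \<open>e\<close> suffices: the only term of the wrong sign,
    \<open>V \<bullet> X\<close>, is at most the squared distance to \<open>?p\<close>.\<close>
  have "\<forall>\<^sub>F Y in nhds ?p. dist Y ?p < e" using e by (simp add: eventually_nhds_metric) blast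
  then show "\<forall>\<^sub>F Y in nhds ?p. ?L ?p + ereal (?u \<bullet> (Y - ?p) - e * norm (Y - ?p)) \<le> ?L Y"
  proof eventually_elim
    case (elim Y)
    obtain z y w where Y: "Y = (z, y, w)" by (cases Y)
    show ?case
    proof (cases "z \<in> feasible_set E I c")
      case False
      then show ?thesis using potential_infinite[OF x] by (simp add: Y)
    next
      case True
      define X V W where "X = z - (x + d)" and "V = y - (\<sigma> *\<^sub>R x - s)" and "W = w - x"
      have zyw: "z = x + d + X" "y = \<sigma> *\<^sub>R x - s + V" "w = x + W"
        by (auto simp: X_def V_def W_def)
      have n: "norm (Y - ?p) < e" using elim by (simp add: dist_norm)
      have le1: "norm X \<le> norm (Y - ?p)" "norm V \<le> norm (Y - ?p)"
      proof -
        have eq: "Y - ?p = (X, V, W)" by (simp add: Y X_def V_def W_def)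
        show "norm X \<le> norm (Y - ?p)" unfolding eq by (rule norm_fst_le[of X "(V, W)", unfolded fst_conv])
        have "norm V \<le> norm (V, W)" using norm_fst_le[of V W] by simp
        also have "\<dots> \<le> norm (Y - ?p)" unfolding eq using norm_snd_le[of "(V, W)" X] by simp
        finally show "norm V \<le> norm (Y - ?p)" .
      qed
      have "V \<bullet> X \<le> norm V * norm X" by (rule norm_cauchy_schwarz)
      also have "\<dots> \<le> norm (Y - ?p) * norm (Y - ?p)" by (intro mult_mono le1) auto
      also have "\<dots> \<le> e * norm (Y - ?p)" using n by (intro mult_right_mono) auto
      finally have VX: "V \<bullet> X \<le> e * norm (Y - ?p)" .
      have "0 \<le> (s + q) \<bullet> X" using normal[OF True] by (simp add: X_def)
      moreover have "0 \<le> \<sigma> / 2 * (norm X)\<^sup>2" "0 \<le> l / 2 * (norm (X - W))\<^sup>2"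
        using l \<sigma> by auto
      \<comment> \<open>Exact expansion of the minorant about \<open>?p\<close>: its value there,
        the linear part given by \<open>?u\<close>, the normal term, the bilinear remainder and two
        squares.\<close>
      moreover have "- (y \<bullet> z) + (y \<bullet> x + fr x - 1/2 * \<sigma> * (norm x)\<^sup>2)
          + 1/2 * \<sigma> * (norm z)\<^sup>2 + 1/2 * l * (norm (z - w))\<^sup>2
        = fr x + s \<bullet> d + (\<sigma> + l) / 2 * (norm d)\<^sup>2
          + (((\<sigma> + l) *\<^sub>R d - q) \<bullet> X - d \<bullet> V - l * (d \<bullet> W))
          + (s + q) \<bullet> X - V \<bullet> X + \<sigma> / 2 * (norm X)\<^sup>2 + l / 2 * (norm (X - W))\<^sup>2"
        unfolding zyw power2_norm_eq_inner
        by (simp add: inner_diff_left inner_add_left inner_diff_right inner_add_right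
          inner_commute field_simps)
      moreover have "?u \<bullet> (Y - ?p) = ((\<sigma> + l) *\<^sub>R d - q) \<bullet> X - d \<bullet> V - l * (d \<bullet> W)"
        by (simp add: Y X_def V_def W_def)
      ultimately have "fr x + s \<bullet> d + (\<sigma> + l) / 2 * (norm d)\<^sup>2 + (?u \<bullet> (Y - ?p) - e * norm (Y - ?p))
         \<le> - (y \<bullet> z) + (y \<bullet> x + fr x - 1/2 * \<sigma> * (norm x)\<^sup>2)
          + 1/2 * \<sigma> * (norm z)\<^sup>2 + 1/2 * l * (norm (z - w))\<^sup>2"
        using VX by linarith
      then have "?L ?p + ereal (?u \<bullet> (Y - ?p) - e * norm (Y - ?p))
        \<le> ereal (- (y \<bullet> z) + (y \<bullet> x + fr x - 1/2 * \<sigma> * (norm x)\<^sup>2)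
          + 1/2 * \<sigma> * (norm z)\<^sup>2 + 1/2 * l * (norm (z - w))\<^sup>2)"
        unfolding Lp plus_ereal.simps ereal_less_eq .
      also have "\<dots> \<le> ?L Y" unfolding Y by (rule potential_ge[OF x])
      finally show ?thesis .
    qed
  qed
qed

lemma continuous_on_constraint: "i \<in> E \<union> I \<Longrightarrow> continuous_on UNIV (c i)"
proof -
  assume "i \<in> E \<union> I"
  then have "c i = (\<lambda>z. a i \<bullet> z + \<beta> i)" using aff by auto
  then show "continuous_on UNIV (c i)" by (simp add: continuous_intros)
qed

lemma closed_feasible_set: "closed (feasible_set E I c)"
proof -
  have "feasible_set E I c = (\<Inter>i\<in>E. {z. c i z = 0}) \<inter> (\<Inter>i\<in>I. {z. 0 \<le> c i z})"
    by (auto simp: feasible_set_def)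
  also have "closed \<dots>"
    by (intro closed_Int closed_INT ballI closed_Collect_eq closed_Collect_le
        continuous_on_constraint continuous_on_const) auto
  finally show ?thesis .
qed

text \<open>Vanishing steps merge the first and third components, and the second one recovers a
  limit of \<open>G\<close> along the subsequence. The subgradient inequality survives this limit,
  so \<open>potential_eq\<close> with step 0 gives the value. As the potential values also converge
  to it, the regular subgradients tending to 0 yield the limiting subgradient 0.\<close>

lemma potential_at_accumulation_point:
  fixes X G d :: "nat \<Rightarrow> 'a"
  defines "Z \<equiv> \<lambda>k. (X k + d k, \<sigma> *\<^sub>R X k - G k, X k)"
  assumes D: "closed D" "continuous_on D fr"
    and X: "\<And>k. X k \<in> D" "\<And>k. upper_subgradient (X k) (G k)" "\<And>k. X k + d k \<in> feasible_set E I c"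
    and d: "d \<longlonglongrightarrow> 0" and fr_lim: "(\<lambda>k. fr (X k)) \<longlonglongrightarrow> L0"
    and pot_lim: "(\<lambda>k. potential E I c f D \<sigma> l (Z k)) \<longlonglongrightarrow> ereal L0"
    and u: "\<And>k. u k \<in> regular_subdiff (potential E I c f D \<sigma> l) (Z k)" "u \<longlonglongrightarrow> 0"
    and p: "accumulation_point Z p"
  shows "potential E I c f D \<sigma> l p = ereal L0"
    and "0 \<in> limiting_subdiff (potential E I c f D \<sigma> l) p"
proof -
  obtain r where r: "strict_mono r" "(Z \<circ> r) \<longlonglongrightarrow> p"
    using p unfolding accumulation_point_def by blast
  obtain p1 p2 p3 where p_eq: "p = (p1, p2, p3)" by (cases p)
  note sub = LIMSEQ_subseq_LIMSEQ[OF _ r(1), unfolded comp_def]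
  have Xr: "(\<lambda>k. X (r k)) \<longlonglongrightarrow> p3" and Yr: "(\<lambda>k. \<sigma> *\<^sub>R X (r k) - G (r k)) \<longlonglongrightarrow> p2"
    and Xdr: "(\<lambda>k. X (r k) + d (r k)) \<longlonglongrightarrow> p1"
    using tendsto_snd[OF tendsto_snd[OF r(2)]] tendsto_fst[OF tendsto_snd[OF r(2)]]
      tendsto_fst[OF r(2)]
    by (simp_all add: Z_def p_eq comp_def)
  have "(\<lambda>k. X (r k) + d (r k)) \<longlonglongrightarrow> p3 + 0"
    by (intro tendsto_add Xr sub[OF d])
  then have p13: "p1 = p3" using LIMSEQ_unique[OF Xdr] by simp
  define s where "s = \<sigma> *\<^sub>R p3 - p2"
  have "(\<lambda>k. \<sigma> *\<^sub>R X (r k) - (\<sigma> *\<^sub>R X (r k) - G (r k))) \<longlonglongrightarrow> s"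
    unfolding s_def by (intro tendsto_intros Xr Yr)
  then have Gr: "(\<lambda>k. G (r k)) \<longlonglongrightarrow> s" by simp
  have p3D: "p3 \<in> D" by (rule closed_sequentially[OF D(1) _ Xr]) (rule X(1))
  have p3F: "p3 \<in> feasible_set E I c"
    using closed_sequentially[OF closed_feasible_set _ Xdr] X(3) p13 by simp
  have frr: "(\<lambda>k. fr (X (r k))) \<longlonglongrightarrow> fr p3"
    by (rule continuous_on_tendsto_compose[OF D(2) Xr p3D]) (simp add: X(1))
  then have fr_p3: "fr p3 = L0" using LIMSEQ_unique[OF _ sub[OF fr_lim]] by blast
  have s_sub: "upper_subgradient p3 s"
  proof
    fix z assume z: "z \<in> D"
    have "(\<lambda>k. fr z - fr (X (r k)) - G (r k) \<bullet> (z - X (r k))) \<longlonglongrightarrow> fr z - fr p3 - s \<bullet> (z - p3)"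
      by (intro tendsto_intros frr Gr Xr)
    moreover have "(\<lambda>k. \<sigma> / 2 * (norm (z - X (r k)))\<^sup>2) \<longlonglongrightarrow> \<sigma> / 2 * (norm (z - p3))\<^sup>2"
      by (intro tendsto_intros Xr)
    ultimately show "fr z - fr p3 - s \<bullet> (z - p3) \<le> \<sigma> / 2 * (norm (z - p3))\<^sup>2"
      by (rule LIMSEQ_le) (use X(2) z in blast)
  qed
  have "potential E I c f D \<sigma> l (p3 + 0, \<sigma> *\<^sub>R p3 - s, p3)
    = ereal (fr p3 + s \<bullet> 0 + (\<sigma> + l) / 2 * (norm (0::'a))\<^sup>2)"
    by (rule potential_eq) (use p3D s_sub p3F in simp_all)
  then show pot_p: "potential E I c f D \<sigma> l p = ereal L0"
    by (simp add: p_eq p13 s_def fr_p3)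
  show "0 \<in> limiting_subdiff (potential E I c f D \<sigma> l) p"
    unfolding limiting_subdiff_def
  proof (intro CollectI conjI, goal_cases)
    case 1
    show ?case by (simp add: pot_p)
  next
    case 2
    have "(\<lambda>k. potential E I c f D \<sigma> l (Z (r k))) \<longlonglongrightarrow> potential E I c f D \<sigma> l p"
      unfolding pot_p by (rule sub[OF pot_lim])
    moreover have "(\<lambda>k. u (r k)) \<longlonglongrightarrow> 0" by (rule sub[OF u(2)])
    moreover have "(\<lambda>k. Z (r k)) \<longlonglongrightarrow> p" using r(2) by (simp add: comp_def)
    ultimately have "(\<lambda>k. Z (r k)) \<longlonglongrightarrow> p \<and>
        (\<lambda>k. potential E I c f D \<sigma> l (Z (r k))) \<longlonglongrightarrow> potential E I c f D \<sigma> l p \<and>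
        (\<forall>k. u (r k) \<in> regular_subdiff (potential E I c f D \<sigma> l) (Z (r k))) \<and>
        (\<lambda>k. u (r k)) \<longlonglongrightarrow> 0"
      using u(1) by simp
    then show ?case
      by (rule exI[of _ "\<lambda>k. Z (r k)", OF exI[of _ "\<lambda>k. u (r k)"]])
  qed
qed

end

theorem theorem5p10:
  fixes E I :: "'i set" and c :: "'i \<Rightarrow> real^'n \<Rightarrow> real" and f :: "real^'n \<Rightarrow> ereal"
    and U D :: "(real^'n) set" and \<rho> H b \<sigma> l \<eta> \<tau> \<gamma> :: real
    and x g d :: "nat \<Rightarrow> real^'n" and B :: "nat \<Rightarrow> real^'n^'n" and \<theta> \<alpha> :: "nat \<Rightarrow> real"
    and v w t lam :: "nat \<Rightarrow> 'i \<Rightarrow> real"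
  assumes index_sets: "finite E" "finite I" "E \<inter> I = {}"
    and f_range: "\<And>z. f z \<noteq> - \<infinity>"
    and params: "0 < \<eta>" "\<eta> < 1" "0 < \<tau>" "\<tau> < 1" "0 < \<gamma>"
    and run: "SQP_run E I c f \<eta> \<tau> \<gamma> x \<theta> g B d v w t lam \<alpha>"
    and A1_open: "open U" "D \<subseteq> U"
    and A1_finite: "\<And>z. z \<in> U \<Longrightarrow> f z \<noteq> \<infinity>"
    and A1_Lipschitz: "\<exists>K. K-lipschitz_on U (\<lambda>z. real_of_ereal (f z))"
    and A1_upper_C2: "upper_C2_on TYPE('t) U f"
    and A1_rho: "0 < \<rho>"
    and A1_convex: "convex_on D (\<lambda>z. - real_of_ereal (f z) + \<rho> / 2 * (norm z)\<^sup>2)"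
    and A1_ineq: "\<And>z zb s. z \<in> D \<Longrightarrow> zb \<in> D \<Longrightarrow> s \<in> clarke_subdiff f zb \<Longrightarrow>
          real_of_ereal (f z) - real_of_ereal (f zb) - s \<bullet> (z - zb) \<le> \<rho> / 2 * (norm (z - zb))\<^sup>2"
    and A2_C1: "\<And>i. i \<in> E \<union> I \<Longrightarrow> c i differentiable_on UNIV \<and> continuous_on UNIV (grad (c i))"
    and A2_Lipschitz: "\<And>i. i \<in> E \<union> I \<Longrightarrow> \<exists>K. K-lipschitz_on UNIV (grad (c i))"
    and A2_H: "0 \<le> H"
      "\<And>i z z'. i \<in> E \<union> I \<Longrightarrow>
          \<bar>c i z' - c i z - grad (c i) z \<bullet> (z' - z)\<bar> \<le> H / 2 * (norm (z - z'))\<^sup>2"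
    and A3_D: "compact D" "convex D" "feasible_set E I c \<subseteq> D"
    and A3_iterates: "\<And>k. x k \<in> D \<and> x k + d k \<in> D"
    and A3_B: "bounded (range B)" "0 < b" "\<And>k z. b * (norm z)\<^sup>2 \<le> z \<bullet> (B k *v z)"
    and MFCQ: "\<And>xh. accumulation_point x xh \<Longrightarrow> MFCQ E I c xh"
    and affine: "\<And>i. i \<in> E \<union> I \<Longrightarrow> \<exists>a \<beta>. \<forall>z. c i z = a \<bullet> z + \<beta>"
    and potential_params: "0 < \<sigma>" "0 < l"
    and F_convex: "convex_ereal_fun (pot_F f D \<sigma>)"
    and KL: "KL_function (potential E I c f D \<sigma> l)"
    and thresholds: "b \<ge> \<sigma>" "\<sigma> \<ge> \<rho>" "2 * b \<ge> \<sigma> + l"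
  shows "\<exists>xb. x \<longlonglongrightarrow> xb \<and> KKT_point E I c f xb"
proof -

  \<comment> \<open>Real-valued objective and affine data\<close>
  define fr where "fr z = real_of_ereal (f z)" for z
  have f_fr: "f z = ereal (fr z)" if "z \<in> U" for z
    using A1_finite[OF that] f_range[of z] by (cases "f z") (auto simp: fr_def)
  obtain K where K: "K-lipschitz_on U fr"
    using A1_Lipschitz by (auto simp: fr_def[abs_def])
  have "\<forall>i\<in>E \<union> I. \<exists>p. \<forall>z. c i z = fst p \<bullet> z + snd p" using affine by fastforce
  then obtain ab where ab: "\<And>i z. i \<in> E \<union> I \<Longrightarrow> c i z = fst (ab i) \<bullet> z + snd (ab i)"
    by (metis bchoice)
  define a \<beta> where "a i = fst (ab i)" and "\<beta> i = snd (ab i)" for i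
  have caff: "c i z = a i \<bullet> z + \<beta> i" "grad (c i) z = a i" if "i \<in> E \<union> I" for i z
    using ab[OF that] grad_affine[of "c i" "a i" "\<beta> i"] by (auto simp: a_def \<beta>_def)
  interpret affine_problem E I c a \<beta> f fr D \<sigma> l
    by unfold_locales (use caff f_fr A1_open(2) potential_params in auto)
  have sum_grad: "(\<Sum>i\<in>E \<union> I. m i *\<^sub>R grad (c i) z) = (\<Sum>i\<in>E \<union> I. m i *\<^sub>R a i)" for m z
    by (rule sum.cong[OF refl]) (simp only: caff(2))
  have finJ: "finite (E \<union> I)" using index_sets by simp
  have lin: "c i z + grad (c i) z \<bullet> d = c i (z + d)" if "i \<in> E \<union> I" for i z d
    using aff[OF that] by (simp add: inner_add_right)

  \<comment> \<open>The run, and acceptance of unit steps\<close>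
  have \<theta>0: "0 < \<theta> 0"
    and g: "g k \<in> clarke_subdiff f (x k)"
    and qp: "qp_feasible E I c (x k) (d k) (v k) (w k) (t k)"
    and no_stop: "\<not> (d k = 0 \<and> violation E I c (x k) = 0)"
    and mult: "qp_multiplier E I c (x k) (\<theta> k) (g k) (B k) (d k) (v k) (w k) (t k) (lam (Suc k))"
    and \<theta>_Suc: "\<theta> (Suc k) = max (\<theta> k) (max_norm_on (E \<union> I) (lam (Suc k)) + \<gamma>)"
    and \<alpha>: "\<exists>j. \<alpha> k = \<tau> ^ j \<and>
           (\<forall>j'<j. \<not> sufficient_decrease E I c f \<eta> (x k) (\<theta> k) (B k) (d k) (\<tau> ^ j'))"
    and x_Suc_\<alpha>: "x (Suc k) = x k + \<alpha> k *\<^sub>R d k" for k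
    using run unfolding SQP_run_def qp_solution_def by blast+
  have \<theta>_mono: "incseq \<theta>" by (rule incseq_SucI) (simp add: \<theta>_Suc)
  have \<theta>_pos: "0 < \<theta> k" for k using incseqD[OF \<theta>_mono, of 0 k] \<theta>0 by simp
  have xD: "x k \<in> D" "x k + d k \<in> D" for k using A3_iterates by auto
  have descent: "fr z - fr (x k) - g k \<bullet> (z - x k) \<le> \<rho> / 2 * (norm (z - x k))\<^sup>2" if "z \<in> D" for k z
    using A1_ineq[OF that xD(1) g] by (simp add: fr_def)
  \<comment> \<open>For affine constraints the linearized violation is the true violation at the
    full step.\<close>
  have slope: "g k \<bullet> d k \<le> - (d k \<bullet> (B k *v d k)) + \<theta> k * violation E I c (x k)
      - \<theta> k * violation E I c (x k + d k)" for k
  proof -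
    have "(\<Sum>i\<in>E. \<bar>c i (x k) + grad (c i) (x k) \<bullet> d k\<bar>)
        + (\<Sum>i\<in>I. max 0 (- (c i (x k) + grad (c i) (x k) \<bullet> d k))) = violation E I c (x k + d k)"
      unfolding violation_def using lin by (intro arg_cong2[of _ _ _ _ "(+)"] sum.cong) auto
    with qp_multiplier_slope[OF index_sets \<theta>_pos qp mult, of k] show ?thesis by simp
  qed

  text \<open>Affine constraints make the merit model exact up to \<open>\<rho>/2 * (norm (d k))\<^sup>2\<close>, so the unit step
    is always accepted.\<close>
  have "sufficient_decrease E I c f \<eta> (x k) (\<theta> k) (B k) (d k) 1" for k
  proof -
    have "fr (x k + d k) - fr (x k) - g k \<bullet> d k \<le> \<rho> / 2 * (norm (d k))\<^sup>2"
      using descent[OF xD(2), of k k] by simp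
    moreover have "\<rho> / 2 * (norm (d k))\<^sup>2 \<le> b / 2 * (norm (d k))\<^sup>2"
      using thresholds by (intro mult_right_mono) auto
    moreover note A3_B(3)[where k = k and z = "d k"]
    moreover have "\<eta> * (d k \<bullet> (B k *v d k)) \<le> 1 * (d k \<bullet> (B k *v d k))"
    proof (rule mult_right_mono)
      have "0 \<le> b * (norm (d k))\<^sup>2" using A3_B(2) by simp
      then show "0 \<le> d k \<bullet> (B k *v d k)" using A3_B(3)[where k = k and z = "d k"] by simp
    qed (use params in simp)
    ultimately have "\<eta> * 1 * (1/2) * (d k \<bullet> (B k *v d k)) \<le> fr (x k) + \<theta> k * violation E I c (x k)
        - (fr (x k + d k) + \<theta> k * violation E I c (x k + d k))"
      using slope[of k] by simp
    then show ?thesis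
      using f_fr xD[of k] A1_open(2) by (simp add: sufficient_decrease_def merit_def subset_iff)
  qed
  \<comment> \<open>The exponent 0 passes the test, so a positive first accepted exponent is
    impossible.\<close>
  then have "\<alpha> k = 1" for k using \<alpha>[of k] by (metis neq0_conv power_0)
  then have x_Suc: "x (Suc k) = x k + d k" for k by (simp add: x_Suc_\<alpha>)

  \<comment> \<open>Uniform bounds and optimality conditions of the subproblem\<close>
  obtain M where M: "0 < M" "\<And>k z. norm (B k *v z) \<le> M * norm z"
    using norm_matrix_vector_mult_bound[OF A3_B(1)] by blast
  obtain R where R: "\<And>z. z \<in> D \<Longrightarrow> norm z \<le> R"
    using compact_imp_bounded[OF A3_D(1)] by (auto simp: bounded_iff)
  have norm_g: "norm (g k) \<le> K" for k
    using xD(1) A1_open by (intro clarke_subdiff_norm_le[OF A1_open(1) _ f_fr K g]) auto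
  have norm_d: "norm (d k) \<le> 2 * R" for k
    using norm_triangle_ineq4[of "x k + d k" "x k"] R[OF xD(1)[of k]] R[OF xD(2)[of k]] by simp
  have stat: "g k + B k *v d k = (\<Sum>i\<in>E \<union> I. lam (Suc k) i *\<^sub>R a i)" for k
  proof -
    have "g k + B k *v d k - (\<Sum>i\<in>E \<union> I. lam (Suc k) i *\<^sub>R grad (c i) (x k)) = 0"
      using mult[of k] unfolding qp_multiplier_def by blast
    then show ?thesis by (simp add: sum_grad)
  qed
  have lam_I: "0 \<le> lam (Suc k) i" "lam (Suc k) i * (c i (x (Suc k)) + t k i) = 0" "0 \<le> t k i"
    if "i \<in> I" for k i
  proof -
    show "0 \<le> lam (Suc k) i" using mult[of k] that unfolding qp_multiplier_def by blast
    show "0 \<le> t k i" using qp[of k] that unfolding qp_feasible_def by blast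
    have "lam (Suc k) i * (c i (x k) + grad (c i) (x k) \<bullet> d k + t k i) = 0"
      using mult[of k] that unfolding qp_multiplier_def by blast
    then show "lam (Suc k) i * (c i (x (Suc k)) + t k i) = 0"
      using lin[of i "x k" "d k"] that by (simp only: x_Suc UnI2)
  qed

  \<comment> \<open>Bounded multipliers and the penalty parameter\<close>
  have "\<exists>\<Lambda>. \<forall>k. \<forall>i\<in>E \<union> I. \<bar>lam (Suc k) i\<bar> \<le> \<Lambda>"
  proof (rule multipliers_bounded[OF index_sets, where z = "\<lambda>k. x (Suc k)" and c = c])
    \<comment> \<open>The points are \<open>x (Suc k)\<close> and not \<open>x k\<close>:
      \<open>lam (Suc k)\<close> is complementary to the constraints linearized at
      \<open>x k\<close>, whose values are those of \<open>c\<close> at \<open>x (Suc k)\<close>.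
      The gradients are constant, so stationarity is unaffected by the shift.\<close>
    show "bounded (range (\<lambda>k. x (Suc k)))" using R xD(1) by (intro boundedI[of _ R]) auto
    show "MFCQ E I c p" if "accumulation_point (\<lambda>k. x (Suc k)) p" for p
      using accumulation_point_shift[of x 1 p] that by (simp add: MFCQ)
    show "continuous_on UNIV (c i) \<and> continuous_on UNIV (grad (c i))" if "i \<in> E \<union> I" for i
      using A2_C1[OF that] continuous_on_constraint[OF that] by blast
    show "norm (\<Sum>i\<in>E \<union> I. lam (Suc k) i *\<^sub>R grad (c i) (x (Suc k))) \<le> K + M * (2 * R)" for k
    proof -
      have "(\<Sum>i\<in>E \<union> I. lam (Suc k) i *\<^sub>R grad (c i) (x (Suc k))) = g k + B k *v d k"
        by (simp add: stat sum_grad)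
      also have "norm \<dots> \<le> norm (g k) + norm (B k *v d k)" by (rule norm_triangle_ineq)
      also have "\<dots> \<le> K + M * (2 * R)"
        using M(1) norm_d[of k] by (intro add_mono norm_g order_trans[OF M(2)]) auto
      finally show ?thesis .
    qed
    show "c i (x (Suc k)) \<le> 0" if "i \<in> I" "0 < lam (Suc k) i" for k i
      using lam_I[OF that(1), of k] that(2) by simp
  qed (use lam_I in blast)
  then obtain \<Lambda> where \<Lambda>: "\<And>k i. i \<in> E \<union> I \<Longrightarrow> \<bar>lam (Suc k) i\<bar> \<le> \<Lambda>" by blast

  text \<open>Each increase of the penalty restores the margin \<open>\<gamma>\<close>, so once \<open>\<theta>\<close> has nearly converged the
    multipliers stay strictly below it and complementarity forces the slacks to vanish.\<close>
  have max_norm_le: "max_norm_on (E \<union> I) (lam (Suc k)) \<le> max 0 \<Lambda>" for k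
    unfolding max_norm_on_def using finJ \<Lambda> by (subst Max_le_iff) (auto simp: le_max_iff_disj)
  have "\<theta> k \<le> max (\<theta> 0) (max 0 \<Lambda> + \<gamma>)" for k
  proof (induction k)
    case (Suc k)
    then show ?case using max_norm_le[of k] by (auto simp: \<theta>_Suc)
  qed simp
  then obtain \<theta>l where \<theta>l: "\<theta> \<longlonglongrightarrow> \<theta>l" "\<And>k. \<theta> k \<le> \<theta>l"
    using incseq_convergent[OF \<theta>_mono] by blast
  have "\<forall>\<^sub>F k in sequentially. \<theta>l - \<gamma> < \<theta> k"
    using \<theta>l(1) params(5) by (intro order_tendstoD) auto
  then obtain N where N: "\<And>k. k \<ge> N \<Longrightarrow> \<theta>l - \<gamma> < \<theta> k"
    unfolding eventually_sequentially by blast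
  have lam_less: "\<bar>lam (Suc k) i\<bar> < \<theta> k" if "k \<ge> N" "i \<in> E \<union> I" for k i
  proof -
    have "\<bar>lam (Suc k) i\<bar> \<le> max_norm_on (E \<union> I) (lam (Suc k))"
      unfolding max_norm_on_def using finJ that(2) by (intro Max_ge) auto
    also have "\<dots> \<le> \<theta> (Suc k) - \<gamma>" by (simp add: \<theta>_Suc)
    finally show ?thesis using \<theta>l(2)[of "Suc k"] N[OF that(1)] by simp
  qed
  have t0: "t k i = 0" if "k \<ge> N" "i \<in> I" for k i
  proof -
    have "(\<theta> k - lam (Suc k) i) * t k i = 0"
      using mult[of k] that(2) unfolding qp_multiplier_def by metis
    then show ?thesis using lam_less[OF that(1), of i] that(2) by auto
  qed

  \<comment> \<open>Eventual feasibility and normal vectors\<close>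
  have x_feas: "x (Suc k) \<in> feasible_set E I c" if "k \<ge> N" for k
  proof -
    have "c i (x (Suc k)) = 0" if i: "i \<in> E" for i
    proof -
      have "(\<theta> k + lam (Suc k) i) * v k i = 0" "(\<theta> k - lam (Suc k) i) * w k i = 0"
        using mult[of k] i unfolding qp_multiplier_def by metis+
      then have "v k i = 0" "w k i = 0" using lam_less[OF \<open>k \<ge> N\<close>, of i] i by auto
      moreover have "c i (x k) + grad (c i) (x k) \<bullet> d k = v k i - w k i"
        using qp[of k] i unfolding qp_feasible_def by blast
      ultimately show ?thesis using lin[of i "x k" "d k"] i by (simp add: x_Suc)
    qed
    moreover have "0 \<le> c i (x (Suc k))" if i: "i \<in> I" for i
    proof -
      have "- t k i \<le> c i (x k) + grad (c i) (x k) \<bullet> d k"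
        using qp[of k] i unfolding qp_feasible_def by blast
      then show ?thesis using t0[OF \<open>k \<ge> N\<close> i] lin[of i "x k" "d k"] i by (simp add: x_Suc)
    qed
    ultimately show ?thesis by (simp add: feasible_set_def)
  qed
  \<comment> \<open>By stationarity the vector is a multiplier combination of gradients, and
    affinity turns its pairing into differences of constraint values. Equality terms vanish; in the
    inequality terms complementarity removes the value at \<open>x (Suc k)\<close>.\<close>
  have normal: "0 \<le> (g k + B k *v d k) \<bullet> (z - x (Suc k))"
    if k: "k \<ge> N" and z: "z \<in> feasible_set E I c" for k z
  proof -
    have "(g k + B k *v d k) \<bullet> (z - x (Suc k)) = (\<Sum>i\<in>E \<union> I. lam (Suc k) i * (c i z - c i (x (Suc k))))"
      unfolding stat inner_sum_left
      using caff(1) by (intro sum.cong) (auto simp: inner_diff_right right_diff_distrib)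
    also have "\<dots> \<ge> 0"
    proof (rule sum_nonneg)
      fix i assume "i \<in> E \<union> I"
      then show "0 \<le> lam (Suc k) i * (c i z - c i (x (Suc k)))"
      proof
        assume "i \<in> E"
        then show ?thesis using z x_feas[OF k] by (simp add: feasible_set_def)
      next
        assume i: "i \<in> I"
        then have "lam (Suc k) i * c i (x (Suc k)) = 0" using lam_I(2)[OF i, of k] t0[OF k i] by simp
        moreover have "0 \<le> lam (Suc k) i * c i z"
          using lam_I(1)[OF i] z i by (simp add: feasible_set_def)
        ultimately show ?thesis unfolding right_diff_distrib by linarith
      qed
    qed
    finally show ?thesis .
  qed

  \<comment> \<open>The feasible tail and its potential values\<close>
  define X where "X k = x (k + Suc N)" for k
  define G where "G k = g (k + Suc N)" for k
  define S where "S k = d (k + Suc N)" for k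
  define Q where "Q k = B (k + Suc N) *v S k" for k
  have X_Suc: "X (Suc k) = X k + S k" for k by (simp add: X_def S_def x_Suc)
  \<comment> \<open>Since \<open>x_feas\<close> concerns \<open>x (Suc k)\<close> for
    \<open>k \<ge> N\<close>, the tail has to start at \<open>Suc N\<close>.\<close>
  have X_feas: "X k \<in> feasible_set E I c" for k by (simp add: X_def x_feas)
  have XD: "X k \<in> D" for k by (simp add: X_def xD)
  have viol0: "violation E I c (X k) = 0" for k
    using X_feas[of k] by (simp add: violation_def feasible_set_def)
  \<comment> \<open>Feasible iterates have zero violation, so an infinite run cannot have a zero
    step here. This later makes \<open>L0 < L k\<close> strict, as the KL inequality
    demands.\<close>
  have S_nz: "S k \<noteq> 0" for k
    using no_stop[of "k + Suc N"] viol0[of k] by (simp add: S_def X_def)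
  have GS: "G k \<bullet> S k \<le> - b * (norm (S k))\<^sup>2" for k
    using slope[of "k + Suc N"] viol0[of k] viol0[of "Suc k"]
      A3_B(3)[where k = "k + Suc N" and z = "S k"]
    unfolding X_Suc by (simp add: G_def S_def X_def)
  have usub: "upper_subgradient (X k) (G k)" for k
  proof
    fix z assume "z \<in> D"
    have "\<rho> / 2 * (norm (z - X k))\<^sup>2 \<le> \<sigma> / 2 * (norm (z - X k))\<^sup>2"
      using thresholds by (intro mult_right_mono) auto
    then show "fr z - fr (X k) - G k \<bullet> (z - X k) \<le> \<sigma> / 2 * (norm (z - X k))\<^sup>2"
      using descent[OF \<open>z \<in> D\<close>, of "k + Suc N"] by (simp add: X_def G_def)
  qed
  define Z where "Z k = (X k + S k, \<sigma> *\<^sub>R X k - G k, X k)" for k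
  define u where "u k = ((\<sigma> + l) *\<^sub>R S k - Q k, - S k, - l *\<^sub>R S k)" for k
  define L where "L k = fr (X k) + G k \<bullet> S k + (\<sigma> + l) / 2 * (norm (S k))\<^sup>2" for k
  let ?pot = "potential E I c f D \<sigma> l"
  have XS_feas: "X k + S k \<in> feasible_set E I c" for k using X_feas[of "Suc k"] by (simp add: X_Suc)
  have pot_Z: "?pot (Z k) = ereal (L k)" for k
    unfolding Z_def L_def by (rule potential_eq[OF XD usub XS_feas])
  have u_sub: "u k \<in> regular_subdiff ?pot (Z k)" for k
    unfolding Z_def u_def
  proof (rule potential_regular_subgradient[OF XD usub XS_feas])
    show "0 \<le> (G k + Q k) \<bullet> (z - (X k + S k))" if "z \<in> feasible_set E I c" for z
      using normal[OF _ that, of "k + Suc N"]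
      by (simp add: G_def Q_def S_def X_def x_Suc)
  qed
  \<comment> \<open>The first component contributes \<open>\<sigma> + l + M\<close>, the second 1
    and the third \<open>l\<close>.\<close>
  have norm_u: "norm (u k) \<le> (\<sigma> + l + M + 1 + l) * norm (S k)" for k
  proof -
    have "norm (u k) \<le> norm ((\<sigma> + l) *\<^sub>R S k - Q k) + (norm (- S k) + norm (- l *\<^sub>R S k))"
      unfolding u_def by (rule order_trans[OF norm_Pair_le add_left_mono[OF norm_Pair_le]])
    moreover have "norm ((\<sigma> + l) *\<^sub>R S k - Q k) \<le> (\<sigma> + l) * norm (S k) + M * norm (S k)"
      using norm_triangle_ineq4[of "(\<sigma> + l) *\<^sub>R S k" "Q k"] M(2)[of "k + Suc N" "S k"] potential_params
      by (simp add: Q_def)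
    ultimately show ?thesis using potential_params by (simp add: algebra_simps)
  qed
  \<comment> \<open>The slope \<open>- b * (norm (S k))\<^sup>2\<close> from \<open>GS\<close>
    absorbs the quadratic term because \<open>2 * b \<ge> \<sigma> + l\<close>.\<close>
  have L_le: "L k \<le> fr (X k)" for k
  proof -
    have "(\<sigma> + l) / 2 * (norm (S k))\<^sup>2 \<le> b * (norm (S k))\<^sup>2"
      using thresholds(3) by (intro mult_right_mono) auto
    then show ?thesis using GS[of k] by (simp add: L_def)
  qed
  \<comment> \<open>The part of \<open>L k\<close> with coefficient \<open>\<sigma> / 2\<close> is
    the upper model of \<open>fr\<close> at \<open>X (Suc k)\<close>; the proximal part is left as
    surplus.\<close>
  have L_ge: "fr (X (Suc k)) + l / 2 * (norm (S k))\<^sup>2 \<le> L k" for k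
    using usub[of k, rule_format, OF XD[of "Suc k"]]
    by (simp add: L_def X_Suc algebra_simps add_divide_distrib)
  have dec: "l / 2 * (norm (S k))\<^sup>2 \<le> L k - L (Suc k)" for k
    using L_ge[of k] L_le[of "Suc k"] by simp

  \<comment> \<open>Convergence of values, steps and subgradients\<close>
  have fr_cont: "continuous_on D fr"
    using lipschitz_on_continuous_on[OF K] A1_open(2) by (rule continuous_on_subset)
  have fr_dec: "decseq (\<lambda>k. fr (X k))"
  proof (rule decseq_SucI)
    fix k
    have "0 \<le> l / 2 * (norm (S k))\<^sup>2" using potential_params by simp
    then show "fr (X (Suc k)) \<le> fr (X k)" using L_ge[of k] L_le[of k] by linarith
  qed
  have "bounded (fr ` D)" using compact_continuous_image[OF fr_cont A3_D(1)] by (rule compact_imp_bounded)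
  then obtain m where "\<And>z. z \<in> D \<Longrightarrow> m \<le> fr z"
    by (metis bounded_imp_bdd_below bdd_below.E imageI)
  then obtain L0 where L0: "(\<lambda>k. fr (X k)) \<longlonglongrightarrow> L0" "\<And>k. L0 \<le> fr (X k)"
    using decseq_convergent[OF fr_dec] XD by metis
  have L_lim: "L \<longlonglongrightarrow> L0"
  proof (rule tendsto_sandwich[OF _ _ LIMSEQ_Suc[OF L0(1)] L0(1)])
    have "fr (X (Suc k)) \<le> L k" for k
      using L_ge[of k] potential_params by (auto intro: order_trans[rotated])
    then show "\<forall>\<^sub>F k in sequentially. fr (X (Suc k)) \<le> L k" by simp
  qed (simp add: L_le)
  have L_gt: "L0 < L k" for k
  proof -
    have "0 < l / 2 * (norm (S k))\<^sup>2" using potential_params S_nz[of k] by simp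
    then show ?thesis using L_ge[of k] L0(2)[of "Suc k"] by linarith
  qed
  have S_lim: "S \<longlonglongrightarrow> 0"
  proof -
    have "(\<lambda>k. 2 / l * (L k - L (Suc k))) \<longlonglongrightarrow> 2 / l * (L0 - L0)"
      by (intro tendsto_intros L_lim LIMSEQ_Suc[OF L_lim])
    then have lim: "(\<lambda>k. 2 / l * (L k - L (Suc k))) \<longlonglongrightarrow> 0" by simp
    have "(norm (S k))\<^sup>2 \<le> 2 / l * (L k - L (Suc k))" for k
      using dec[of k] potential_params by (simp add: field_simps)
    then have "(\<lambda>k. (norm (S k))\<^sup>2) \<longlonglongrightarrow> 0"
      by (intro tendsto_sandwich[OF _ _ tendsto_const lim]) auto
    then have "(\<lambda>k. sqrt ((norm (S k))\<^sup>2)) \<longlonglongrightarrow> sqrt 0" by (rule tendsto_real_sqrt)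
    then show ?thesis by (simp add: tendsto_norm_zero_iff)
  qed
  have u_lim: "u \<longlonglongrightarrow> 0"
  proof (rule Lim_null_comparison)
    show "\<forall>\<^sub>F k in sequentially. norm (u k) \<le> (\<sigma> + l + M + 1 + l) * norm (S k)"
      using norm_u by simp
    show "(\<lambda>k. (\<sigma> + l + M + 1 + l) * norm (S k)) \<longlonglongrightarrow> 0"
      using tendsto_mult_right_zero[OF tendsto_norm_zero[OF S_lim]] .
  qed

  \<comment> \<open>Finite length through the KL inequality\<close>
  have acc: "?pot p = ereal L0 \<and> KL_property_at ?pot p" if "accumulation_point Z p" for p
  proof -
    note that' = that[unfolded Z_def[abs_def]]
    have "(\<lambda>k. ?pot (X k + S k, \<sigma> *\<^sub>R X k - G k, X k)) \<longlonglongrightarrow> ereal L0"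
      using L_lim by (simp add: pot_Z[unfolded Z_def])
    \<comment> \<open>\<open>KL_function\<close> speaks only of points with nonempty limiting
      subdifferential; membership of 0 provides this.\<close>
    note * = potential_at_accumulation_point[OF compact_imp_closed[OF A3_D(1)] fr_cont XD usub XS_feas
        S_lim L0(1) this u_sub[unfolded Z_def] u_lim that']
    then show ?thesis using KL unfolding KL_function_def by blast
  qed
  have "bounded (range Z)"
  proof (rule boundedI)
    fix y assume "y \<in> range Z"
    then obtain k where y: "y = Z k" by blast
    have "norm y \<le> norm (X (Suc k)) + (norm (\<sigma> *\<^sub>R X k - G k) + norm (X k))"
      unfolding y Z_def X_Suc by (rule order_trans[OF norm_Pair_le add_left_mono[OF norm_Pair_le]])
    also have "\<dots> \<le> R + ((\<sigma> * R + K) + R)"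
      using R[OF XD] norm_g[of "k + Suc N"] potential_params
      by (intro add_mono order_trans[OF norm_triangle_ineq4]) (auto simp: G_def)
    finally show "norm y \<le> R + ((\<sigma> * R + K) + R)" .
  qed
  then have "summable (\<lambda>k. norm (S k))"
    using acc pot_Z L_lim L_gt dec u_sub regular_subdiff_subset_limiting norm_u
      potential_params M(1)
    by (intro KL_finite_length[where z = Z and h = ?pot and L = L and m = "l / 2"]) (blast | simp)+
  then have "summable S" by (rule summable_norm_cancel)
  then have "(\<lambda>n. X 0 + (\<Sum>k<n. X (Suc k) - X k)) \<longlonglongrightarrow> X 0 + suminf S"
    by (intro tendsto_intros) (simp add: X_Suc summable_LIMSEQ)
  then have "X \<longlonglongrightarrow> X 0 + suminf S" by (simp add: sum_lessThan_telescope)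
  then obtain xb where xb: "X \<longlonglongrightarrow> xb" ..
  then have x_lim: "x \<longlonglongrightarrow> xb" unfolding X_def by (rule LIMSEQ_offset)

  \<comment> \<open>The limit is a KKT point\<close>
  have xb_feas: "xb \<in> feasible_set E I c"
    by (rule closed_sequentially[OF closed_feasible_set _ xb]) (rule X_feas)
  \<comment> \<open>Subgradients and multipliers need converge only along a subsequence, since the
    iterates themselves already converge.\<close>
  have "bounded (range G)" using norm_g by (intro boundedI[of _ K]) (auto simp: G_def)
  then obtain r gb where r: "strict_mono r" "(G \<circ> r) \<longlonglongrightarrow> gb"
    using bounded_imp_convergent_subsequence by blast
  have "bounded (range (\<lambda>k. lam (Suc (r k + Suc N)) i))" if "i \<in> E \<union> I" for i
    using \<Lambda>[OF that] by (intro boundedI[of _ \<Lambda>]) auto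
  then obtain q \<mu> where q: "strict_mono q"
    "\<And>i. i \<in> E \<union> I \<Longrightarrow> (\<lambda>k. lam (Suc (r (q k) + Suc N)) i) \<longlonglongrightarrow> \<mu> i"
    using bounded_family_convergent_subseq[OF finJ, of "\<lambda>k. lam (Suc (r k + Suc N))"] by blast
  define j where "j k = r (q k)" for k
  have j: "strict_mono j" using r(1) q(1) by (auto simp: j_def strict_mono_def)
  have Gj: "(\<lambda>k. G (j k)) \<longlonglongrightarrow> gb"
    using LIMSEQ_subseq_LIMSEQ[OF r(2) q(1)] by (simp add: j_def comp_def)
  have lamj: "(\<lambda>k. lam (Suc (j k + Suc N)) i) \<longlonglongrightarrow> \<mu> i" if "i \<in> E \<union> I" for i
    using q(2)[OF that] by (simp add: j_def)
  note sub = LIMSEQ_subseq_LIMSEQ[OF _ j, unfolded comp_def]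
  have gb: "gb \<in> clarke_subdiff f xb"
    by (rule clarke_subdiff_closed_graph[OF sub[OF xb] Gj]) (simp add: G_def X_def g)
  have "Q \<longlonglongrightarrow> 0"
  proof (rule Lim_null_comparison)
    show "\<forall>\<^sub>F k in sequentially. norm (Q k) \<le> M * norm (S k)" by (simp add: Q_def M(2))
    show "(\<lambda>k. M * norm (S k)) \<longlonglongrightarrow> 0"
      using tendsto_mult_right_zero[OF tendsto_norm_zero[OF S_lim]] .
  qed
  then have "(\<lambda>k. G (j k) + Q (j k)) \<longlonglongrightarrow> gb + 0" by (intro tendsto_add Gj sub)
  moreover have "(\<lambda>k. G (j k) + Q (j k)) \<longlonglongrightarrow> (\<Sum>i\<in>E \<union> I. \<mu> i *\<^sub>R a i)"
    unfolding G_def Q_def S_def stat by (intro tendsto_intros lamj)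
  ultimately have gb_eq: "gb = (\<Sum>i\<in>E \<union> I. \<mu> i *\<^sub>R a i)"
    using LIMSEQ_unique by fastforce
  have \<mu>_I: "0 \<le> \<mu> i \<and> \<mu> i * c i xb = 0" if i: "i \<in> I" for i
  proof
    have iJ: "i \<in> E \<union> I" using i by simp
    show "0 \<le> \<mu> i" by (rule LIMSEQ_le_const[OF lamj[OF iJ]]) (use lam_I(1)[OF i] in blast)
    have "isCont (c i) xb"
      using continuous_on_constraint[OF iJ] by (simp add: continuous_on_eq_continuous_at)
    then have "(\<lambda>k. c i (X (Suc (j k)))) \<longlonglongrightarrow> c i xb"
      using isCont_tendsto_compose sub[OF LIMSEQ_Suc[OF xb]] by blast
    then have "(\<lambda>k. lam (Suc (j k + Suc N)) i * c i (X (Suc (j k)))) \<longlonglongrightarrow> \<mu> i * c i xb"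
      by (intro tendsto_mult lamj iJ)
    \<comment> \<open>The index of the multiplier is one ahead of its subproblem, hence
      complementarity holds at \<open>X (Suc (j k))\<close>; the slack is zero because the index is
      beyond \<open>N\<close>.\<close>
    moreover have "lam (Suc (j k + Suc N)) i * c i (X (Suc (j k))) = 0" for k
      using lam_I(2)[OF i, of "j k + Suc N"] t0[of "j k + Suc N" i] i by (simp add: X_def)
    ultimately show "\<mu> i * c i xb = 0" by (simp only: LIMSEQ_const_iff)
  qed
  have "0 = gb - (\<Sum>i\<in>E \<union> I. \<mu> i *\<^sub>R grad (c i) xb)"
    by (simp add: gb_eq sum_grad)
  then have "KKT_point E I c f xb"
    unfolding KKT_point_def using gb \<mu>_I xb_feas by blast
  then show ?thesis using x_lim by blast
qed

end
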